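(* Let $(\omega,c)\in\mathbb{R}^2$ satisfy: $\omega>c^2/4$, or $\omega=c^2/4$ and $c>0$. For $L>L_0(\omega,c)$ let $\Phi^L_{\omega,c}$ be the function on $[-L,L]$ defined below. Then for every integer $m\ge0$, $$\lim_{L\to\infty}\bigl\|\Phi^L_{\omega,c}-\Phi_{\omega,c}\bigr\|_{C^m([-L,L])}=0.$$
   Context: Set $\alpha_0=\tfrac13(4c+\sqrt{48\omega+4c^2})$, $\alpha_1=4\sqrt\omega+2c$, $A(x)=-3x^2+8cx+64\omega$, $L_0(\omega,c)=2\pi/\sqrt{\alpha_0\sqrt{A(\alpha_0)}}$. For $\eta_3\in(\alpha_0,\alpha_1)$ put $\eta_1=\frac{-\eta_3+4c-\sqrt{A(\eta_3)}}{2}$, $\eta_2=\frac{-\eta_3+4c+\sqrt{A(\eta_3)}}{2}$ (one has $\eta_1<0<\eta_2<\eta_3$), $k^2=\frac{-\eta_1(\eta_3-\eta_2)}{\eta_3(\eta_2-\eta_1)}\in(0,1)$, $g=\frac{2}{\sqrt{\eta_3(\eta_2-\eta_1)}}$, $\beta^2=-\eta_3k^2/\eta_1$, and $T(\eta_3)=4gK(k)$, where $K(k)=\int_0^{\pi/2}(1-k^2\sin^2\theta)^{-1/2}d\theta$. The map $\eta_3\mapsto T(\eta_3)$ is a strictly increasing bijection of $(\alpha_0,\alpha_1)$ onto $(2L_0,\infty)$; for $L>L_0$ let $\eta_3$ be the unique value with $T(\eta_3)=2L$, and define the positive function $\Phi^L_{\omega,c}$ on $[-L,L]$ by $(\Phi^L_{\omega,c}(x))^2=\eta_3\,\mathrm{dn}^2(\frac{x}{2g};k)/(1+\beta^2\mathrm{sn}^2(\frac{x}{2g};k))$,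 with $\mathrm{sn},\mathrm{dn}$ the Jacobi elliptic functions of modulus $k$. $\Phi_{\omega,c}$ is the function on $\mathbb{R}$ with $\Phi_{\omega,c}>0$ and $\Phi_{\omega,c}^2(x)=\frac{4\omega-c^2}{\sqrt\omega(\cosh(\sqrt{4\omega-c^2}x)-\frac{c}{2\sqrt\omega})}$ if $\omega>c^2/4$, $\Phi_{\omega,c}^2(x)=\frac{4c}{(cx)^2+1}$ if $\omega=c^2/4,\ c>0$. $\|f\|_{C^m([-L,L])}=\sum_{j=0}^m\sup_{[-L,L]}|f^{(j)}|$. *)

theory Defs
  imports "HOL-Analysis.Analysis"
begin

definition ellF :: "real \<Rightarrow> real \<Rightarrow> real" where
  "ellF k phi = (if 0 \<le> phi
     then integral {0..phi} (\<lambda>\<theta>. 1 / sqrt (1 - k\<^sup>2 * (sin \<theta>)\<^sup>2))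
     else - integral {phi..0} (\<lambda>\<theta>. 1 / sqrt (1 - k\<^sup>2 * (sin \<theta>)\<^sup>2)))"

definition ellK :: "real \<Rightarrow> real" where
  "ellK k = integral {0..pi/2} (\<lambda>\<theta>. 1 / sqrt (1 - k\<^sup>2 * (sin \<theta>)\<^sup>2))"

definition jam :: "real \<Rightarrow> real \<Rightarrow> real" where
  "jam k u = (THE phi. ellF k phi = u)"

definition jsn :: "real \<Rightarrow> real \<Rightarrow> real" where
  "jsn k u = sin (jam k u)"

definition jdn :: "real \<Rightarrow> real \<Rightarrow> real" where
  "jdn k u = sqrt (1 - k\<^sup>2 * (sin (jam k u))\<^sup>2)"

definition alpha0 :: "real \<Rightarrow> real \<Rightarrow> real" where
  "alpha0 \<omega> c = (4*c + sqrt (48*\<omega> + 4*c\<^sup>2)) / 3"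

definition alpha1 :: "real \<Rightarrow> real \<Rightarrow> real" where
  "alpha1 \<omega> c = 4 * sqrt \<omega> + 2*c"

definition Apol :: "real \<Rightarrow> real \<Rightarrow> real \<Rightarrow> real" where
  "Apol \<omega> c x = -3*x\<^sup>2 + 8*c*x + 64*\<omega>"

definition L0 :: "real \<Rightarrow> real \<Rightarrow> real" where
  "L0 \<omega> c = 2*pi / sqrt (alpha0 \<omega> c * sqrt (Apol \<omega> c (alpha0 \<omega> c)))"

definition eta1 :: "real \<Rightarrow> real \<Rightarrow> real \<Rightarrow> real" where
  "eta1 \<omega> c e3 = (- e3 + 4*c - sqrt (Apol \<omega> c e3)) / 2"

definition eta2 :: "real \<Rightarrow> real \<Rightarrow> real \<Rightarrow> real" where
  "eta2 \<omega> c e3 = (- e3 + 4*c + sqrt (Apol \<omega> c e3)) / 2"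

definition ksq :: "real \<Rightarrow> real \<Rightarrow> real \<Rightarrow> real" where
  "ksq \<omega> c e3 = (- eta1 \<omega> c e3 * (e3 - eta2 \<omega> c e3)) / (e3 * (eta2 \<omega> c e3 - eta1 \<omega> c e3))"

definition kmod :: "real \<Rightarrow> real \<Rightarrow> real \<Rightarrow> real" where
  "kmod \<omega> c e3 = sqrt (ksq \<omega> c e3)"

definition gpar :: "real \<Rightarrow> real \<Rightarrow> real \<Rightarrow> real" where
  "gpar \<omega> c e3 = 2 / sqrt (e3 * (eta2 \<omega> c e3 - eta1 \<omega> c e3))"

definition betasq :: "real \<Rightarrow> real \<Rightarrow> real \<Rightarrow> real" where
  "betasq \<omega> c e3 = - e3 * ksq \<omega> c e3 / eta1 \<omega> c e3"

definition Tper :: "real \<Rightarrow> real \<Rightarrow> real \<Rightarrow> real" where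
  "Tper \<omega> c e3 = 4 * gpar \<omega> c e3 * ellK (kmod \<omega> c e3)"

definition eta3L :: "real \<Rightarrow> real \<Rightarrow> real \<Rightarrow> real" where
  "eta3L \<omega> c L = (THE e3. alpha0 \<omega> c < e3 \<and> e3 < alpha1 \<omega> c \<and> Tper \<omega> c e3 = 2*L)"

text \<open>Periodic wave Phi^L (given by its formula; this is a smooth function on the real
  line whose restriction to [-L,L] is the paper's function).\<close>
definition PhiL :: "real \<Rightarrow> real \<Rightarrow> real \<Rightarrow> real \<Rightarrow> real" where
  "PhiL \<omega> c L x = (let e3 = eta3L \<omega> c L; k = kmod \<omega> c e3; g = gpar \<omega> c e3;
      b2 = betasq \<omega> c e3 in
      sqrt (e3 * (jdn k (x / (2*g)))\<^sup>2 / (1 + b2 * (jsn k (x / (2*g)))\<^sup>2)))"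

definition Phi :: "real \<Rightarrow> real \<Rightarrow> real \<Rightarrow> real" where
  "Phi \<omega> c x = (if \<omega> > c\<^sup>2 / 4
     then sqrt ((4*\<omega> - c\<^sup>2) / (sqrt \<omega> * (cosh (sqrt (4*\<omega> - c\<^sup>2) * x) - c / (2 * sqrt \<omega>))))
     else sqrt (4*c / ((c*x)\<^sup>2 + 1)))"

definition Cm_norm :: "nat \<Rightarrow> real \<Rightarrow> (real \<Rightarrow> real) \<Rightarrow> real" where
  "Cm_norm m L f = (\<Sum>j\<le>m. Sup ((\<lambda>x. \<bar>(deriv ^^ j) f x\<bar>) ` {-L..L}))"

end

theory Submission
  imports Defs "HOL-Analysis.Weierstrass_Theorems"
begin

text \<open>
  \<open>PhiL\<close> and \<open>Phi\<close> are both even solutions of one autonomous equation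
  \<open>f'' = (\<omega> - c\<^sup>2/4) f + (c/2) f^3 - (3/16) f^5\<close>; only their values at \<open>0\<close>, namely
  \<open>sqrt \<eta>\<^sub>3\<close> and \<open>sqrt \<alpha>\<^sub>1\<close>, differ.  Every derivative of a solution is a fixed polynomial in
  \<open>(f, f')\<close>, so uniform convergence of \<open>(f, f')\<close> suffices.  On a compact interval this is continuous
  dependence on the initial value.  Beyond it \<open>PhiL\<close> is squeezed by its monotonicity on \<open>[0, L]\<close>
  and the derivative is controlled by the conserved energy, which tends to \<open>0\<close>.

  That \<open>\<eta>\<^sub>3\<close> is well defined and tends to \<open>\<alpha>\<^sub>1\<close> comes from writing the period as Gauss's integral
  of \<open>8 / sqrt (P cos\<^sup>2 t + N sin\<^sup>2 t)\<close> with \<open>P = \<eta>\<^sub>3 (\<eta>\<^sub>2 - \<eta>\<^sub>1)\<close> and \<open>N = \<eta>\<^sub>2 (\<eta>\<^sub>3 - \<eta>\<^sub>1)\<close>.  Both \<open>N\<close> and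
  \<open>P + N\<close> decrease in \<open>\<eta>\<^sub>3\<close>, which forces the period to increase, and \<open>N\<close> tends to \<open>0\<close> at \<open>\<alpha>\<^sub>1\<close>,
  which makes it diverge.
\<close>

section \<open>The Jacobi amplitude\<close>

lemma elliptic_radicand_pos:
  fixes k t :: real
  assumes "k\<^sup>2 < 1"
  shows "0 < 1 - k\<^sup>2 * (sin t)\<^sup>2"
proof -
  have "k\<^sup>2 * (sin t)\<^sup>2 \<le> k\<^sup>2 * 1"
    by (intro mult_left_mono) (auto simp: abs_square_le_1)
  then show ?thesis using assms by linarith
qed

lemma ellF_has_real_derivative:
  assumes k: "k\<^sup>2 < 1"
  shows "(ellF k has_real_derivative 1 / sqrt (1 - k\<^sup>2 * (sin t)\<^sup>2)) (at t)"
proof -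
  let ?h = "\<lambda>\<theta>. 1 / sqrt (1 - k\<^sup>2 * (sin \<theta>)\<^sup>2)"
  \<comment> \<open>With the base point \<open>-b\<close> to the left of both \<open>0\<close> and
    \<open>t\<close>, the two branches of \<open>ellF\<close> become one integral with variable
    upper limit minus a constant, and \<open>t\<close> is an interior point.\<close>
  define b where "b = \<bar>t\<bar> + 1"
  have nz: "1 - k\<^sup>2 * (sin \<theta>)\<^sup>2 \<noteq> 0" for \<theta>
    using elliptic_radicand_pos[OF k, of \<theta>] by simp
  have cont: "continuous_on S ?h" for S
    by (intro continuous_intros) (use nz in auto)
  have int: "?h integrable_on {x..y}" for x y
    by (intro integrable_continuous_interval cont)
  have eq: "ellF k x = integral {-b..x} ?h - integral {-b..0} ?h" if "x \<in> {-b..b}" for x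
  proof (cases "0 \<le> x")
    case True
    have "integral {-b..0} ?h + integral {0..x} ?h = integral {-b..x} ?h"
      using that True by (intro Henstock_Kurzweil_Integration.integral_combine int) (auto simp: b_def)
    then show ?thesis using True by (simp add: ellF_def)
  next
    case False
    have "integral {-b..x} ?h + integral {x..0} ?h = integral {-b..0} ?h"
      using that False by (intro Henstock_Kurzweil_Integration.integral_combine int) auto
    then show ?thesis using False by (simp add: ellF_def)
  qed
  have mem: "t \<in> {-b..b}" "t \<in> interior {-b..b}" by (auto simp: b_def)
  have "((\<lambda>x. integral {-b..x} ?h) has_real_derivative ?h t) (at t within {-b..b})"
    by (rule integral_has_real_derivative) (use cont mem in auto)
  then have "((\<lambda>x. integral {-b..x} ?h - integral {-b..0} ?h) has_real_derivative ?h t) (at t within {-b..b})"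
    by (auto intro!: derivative_eq_intros)
  then have "(ellF k has_real_derivative ?h t) (at t within {-b..b})"
    by (rule has_field_derivative_transform_within[OF _ zero_less_one mem(1), where g = "ellF k"])
       (simp_all add: eq)
  then show ?thesis
    using at_within_interior[OF mem(2)] by simp
qed

text \<open>The integrand is at least 1. This one bound yields injectivity of \<open>ellF k\<close>
  and also the brackets for surjectivity.\<close>

lemma ellF_expanding:
  assumes k: "k\<^sup>2 < 1" and "x \<le> y"
  shows "y - x \<le> ellF k y - ellF k x"
proof -
  have "ellF k x - x \<le> ellF k y - y"
  proof (rule DERIV_nonneg_imp_nondecreasing[OF \<open>x \<le> y\<close>])
    fix t
    have "0 < 1 - k\<^sup>2 * (sin t)\<^sup>2" by (rule elliptic_radicand_pos[OF k])
    then have "1 \<le> 1 / sqrt (1 - k\<^sup>2 * (sin t)\<^sup>2)" by simp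
    moreover have "((\<lambda>x. ellF k x - x) has_real_derivative 1 / sqrt (1 - k\<^sup>2 * (sin t)\<^sup>2) - 1) (at t)"
      by (intro DERIV_diff ellF_has_real_derivative k DERIV_ident)
    ultimately show "\<exists>z. ((\<lambda>x. ellF k x - x) has_real_derivative z) (at t) \<and> 0 \<le> z"
      by (meson diff_ge_0_iff_ge)
  qed
  then show ?thesis by simp
qed

lemma ellF_0 [simp]: "ellF k 0 = 0"
  by (simp add: ellF_def)

lemma ellF_half_pi: "ellF k (pi/2) = ellK k"
  by (simp add: ellF_def ellK_def)

lemma ellF_eq_iff:
  assumes "k\<^sup>2 < 1"
  shows "ellF k x = ellF k y \<longleftrightarrow> x = y"
  using ellF_expanding[OF assms, of x y] ellF_expanding[OF assms, of y x] by fastforce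

lemma jam_ellF:
  assumes "k\<^sup>2 < 1"
  shows "jam k (ellF k t) = t"
  unfolding jam_def by (rule the_equality) (auto simp: ellF_eq_iff[OF assms])

lemma ellF_jam:
  assumes k: "k\<^sup>2 < 1"
  shows "ellF k (jam k u) = u"
proof -
  \<comment> \<open>Expansion away from \<open>ellF k 0 = 0\<close> brackets \<open>u\<close>
    between the values at \<open>-\<bar>u\<bar>\<close> and \<open>\<bar>u\<bar>\<close>, so the THE
    in \<open>jam\<close> is satisfied for every real \<open>u\<close>.\<close>
  have "\<exists>x\<ge>-\<bar>u\<bar>. x \<le> \<bar>u\<bar> \<and> ellF k x = u"
  proof (rule IVT)
    show "\<forall>x. - \<bar>u\<bar> \<le> x \<and> x \<le> \<bar>u\<bar> \<longrightarrow> isCont (ellF k) x"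
      using ellF_has_real_derivative[OF k] DERIV_isCont by blast
    show "ellF k (- \<bar>u\<bar>) \<le> u" using ellF_expanding[OF k, of "-\<bar>u\<bar>" 0] by simp
    show "u \<le> ellF k \<bar>u\<bar>" using ellF_expanding[OF k, of 0 "\<bar>u\<bar>"] by simp
  qed simp
  then show ?thesis using jam_ellF[OF k] by auto
qed

lemma jam_mono:
  assumes k: "k\<^sup>2 < 1" and "u \<le> w"
  shows "jam k u \<le> jam k w"
  using ellF_expanding[OF k, of "jam k w" "jam k u"] assms(2) ellF_jam[OF k] by fastforce

lemma jam_has_real_derivative:
  assumes k: "k\<^sup>2 < 1"
  shows "(jam k has_real_derivative sqrt (1 - k\<^sup>2 * (sin (jam k u))\<^sup>2)) (at u)"
proof -
  let ?t = "jam k u"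
  have pos: "0 < 1 - k\<^sup>2 * (sin ?t)\<^sup>2" by (rule elliptic_radicand_pos[OF k])
  \<comment> \<open>The inverse function rule asks for continuity of the inverse; it comes from
    \<open>jam k\<close> being a left inverse of the continuous \<open>ellF k\<close>.\<close>
  have "isCont (jam k) (ellF k ?t)"
    by (rule isCont_inverse_function[of 1 _ _ "ellF k"])
       (use jam_ellF[OF k] DERIV_isCont[OF ellF_has_real_derivative[OF k]] in auto)
  then have "isCont (jam k) u" by (simp add: ellF_jam[OF k])
  then have "(jam k has_real_derivative inverse (1 / sqrt (1 - k\<^sup>2 * (sin ?t)\<^sup>2))) (at u)"
    by (intro DERIV_inverse_function[where f = "ellF k" and a = "u - 1" and b = "u + 1"]
        ellF_has_real_derivative k) (use pos ellF_jam[OF k] in auto)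
  then show ?thesis by (simp add: inverse_eq_divide)
qed

lemma jam_0 [simp]: "k\<^sup>2 < 1 \<Longrightarrow> jam k 0 = 0"
  using jam_ellF[of k 0] by simp

lemma jam_ellK: "k\<^sup>2 < 1 \<Longrightarrow> jam k (ellK k) = pi/2"
  using jam_ellF[of k "pi/2"] by (simp add: ellF_half_pi)

lemma ellF_minus:
  "ellF k (- t) = - ellF k t"
proof -
  have "integral {-x..0} (\<lambda>\<theta>. 1 / sqrt (1 - k\<^sup>2 * (sin \<theta>)\<^sup>2)) =
        integral {0..x} (\<lambda>\<theta>. 1 / sqrt (1 - k\<^sup>2 * (sin \<theta>)\<^sup>2))" for x
    using Henstock_Kurzweil_Integration.integral_reflect_real[of x 0 "\<lambda>\<theta>. 1 / sqrt (1 - k\<^sup>2 * (sin \<theta>)\<^sup>2)"] by simp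
  from this[of t] this[of "-t"] show ?thesis by (auto simp: ellF_def)
qed

lemma jam_minus:
  assumes "k\<^sup>2 < 1"
  shows "jam k (- u) = - jam k u"
  by (metis assms ellF_jam ellF_minus jam_ellF)

section \<open>Gauss's integral and the period\<close>

text \<open>Classically this is pi/2 divided by the arithmetic-geometric mean of
  \<open>sqrt p\<close> and \<open>sqrt n\<close>. Unlike a scaled \<open>ellK\<close>, the form
  shows the symmetry in the two arguments.\<close>

definition gauss_integral :: "real \<Rightarrow> real \<Rightarrow> real" where
  "gauss_integral p n = integral {0..pi/2} (\<lambda>t. 1 / sqrt (p * (cos t)\<^sup>2 + n * (sin t)\<^sup>2))"

lemma gauss_radicand_pos:
  fixes p n t :: real
  assumes "0 < p" "0 < n"
  shows "0 < p * (cos t)\<^sup>2 + n * (sin t)\<^sup>2"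
proof (cases "cos t = 0")
  case True
  then have "(sin t)\<^sup>2 = 1" using sin_cos_squared_add[of t] by simp
  then show ?thesis using True assms by simp
next
  case False
  then show ?thesis using assms by (intro add_pos_nonneg) auto
qed

lemma gauss_integrand_continuous:
  assumes "0 < p" "0 < n"
  shows "continuous_on S (\<lambda>t::real. 1 / sqrt (p * (cos t)\<^sup>2 + n * (sin t)\<^sup>2))"
proof -
  have "p * (cos t)\<^sup>2 + n * (sin t)\<^sup>2 \<noteq> 0" for t
    using gauss_radicand_pos[OF assms, of t] by simp
  then show ?thesis by (intro continuous_intros) auto
qed

lemma gauss_integral_commute:
  assumes "0 < p" "0 < n"
  shows "gauss_integral n p = gauss_integral p n"
proof -
  let ?h = "\<lambda>t. 1 / sqrt (p * (cos t)\<^sup>2 + n * (sin t)\<^sup>2)"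
  have "?h integrable_on cbox 0 (pi/2)"
    by (intro integrable_continuous gauss_integrand_continuous assms)
  then have "(?h has_integral gauss_integral p n) (cbox 0 (pi/2))"
    by (simp add: gauss_integral_def has_integral_integral)
  \<comment> \<open>The reflection \<open>t \<mapsto> pi/2 - t\<close> exchanges sine and
    cosine.\<close>
  from has_integral_affinity[OF this, of "-1" "pi/2"]
  have "((\<lambda>t. ?h (pi/2 - t)) has_integral gauss_integral p n) ((\<lambda>x. pi/2 - x) ` {0..pi/2})"
    by (simp add: algebra_simps)
  then have "((\<lambda>t. ?h (pi/2 - t)) has_integral gauss_integral p n) {0..pi/2}"
    by simp
  moreover have "?h (pi/2 - t) = 1 / sqrt (n * (cos t)\<^sup>2 + p * (sin t)\<^sup>2)" for t
    by (simp add: cos_diff sin_diff add.commute)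
  ultimately show ?thesis
    by (simp add: gauss_integral_def integral_unique)
qed

text \<open>The square of the sum is \<open>(p + q) / (p * q) + 2 / sqrt (p * q)\<close>: at fixed
  sum it depends only on the product, and decreases in it.\<close>

lemma sum_inverse_sqrt_mono:
  fixes p q p' q' :: real
  assumes "0 < p" "0 < q" "0 < p'" "0 < q'" and sum: "p' + q' = p + q" and prod: "p' * q' \<le> p * q"
  shows "1 / sqrt p + 1 / sqrt q \<le> 1 / sqrt p' + 1 / sqrt q'"
proof (rule power2_le_imp_le)
  have sq: "(1 / sqrt x + 1 / sqrt y)\<^sup>2 = (x + y) / (x * y) + 2 / sqrt (x * y)"
    if "0 < x" "0 < y" for x y :: real
    using that by (simp add: power2_sum power_divide real_sqrt_mult field_simps)
  have "(p + q) / (p * q) \<le> (p + q) / (p' * q')"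
    using assms by (intro divide_left_mono) auto
  moreover have "2 / sqrt (p * q) \<le> 2 / sqrt (p' * q')"
    using assms by (intro divide_left_mono) auto
  ultimately show "(1 / sqrt p + 1 / sqrt q)\<^sup>2 \<le> (1 / sqrt p' + 1 / sqrt q')\<^sup>2"
    using assms by (simp add: sq)
qed (use assms in simp)

lemma gauss_integral_strict_antimono:
  assumes "0 < p'" "0 < n'" "p' \<le> p" "n' < n"
  shows "gauss_integral p n < gauss_integral p' n'"
  unfolding gauss_integral_def
proof (rule integral_less_real)
  fix t assume t: "t \<in> {0<..<pi/2}"
  then have "0 < sin t" by (intro sin_gt_zero) auto
  then have "p' * (cos t)\<^sup>2 + n' * (sin t)\<^sup>2 < p * (cos t)\<^sup>2 + n * (sin t)\<^sup>2"
    using assms by (intro add_le_less_mono mult_right_mono) auto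
  then show "1 / sqrt (p * (cos t)\<^sup>2 + n * (sin t)\<^sup>2) < 1 / sqrt (p' * (cos t)\<^sup>2 + n' * (sin t)\<^sup>2)"
    using gauss_radicand_pos[of p' n' t] assms by (intro divide_strict_left_mono) auto
qed (use assms pi_gt_zero in \<open>auto intro!: gauss_integrand_continuous simp del: pi_gt_zero\<close>)

text \<open>Symmetrising under \<open>t \<mapsto> pi/2 - t\<close> makes the integrand decrease in \<open>p + n\<close> and increase in
  \<open>\<bar>p - n\<bar>\<close>, so that \<open>p\<close> itself need not be monotone.\<close>

lemma gauss_integral_less:
  assumes pos: "0 < n'" "n \<le> p" "n' \<le> p'" and less: "n' < n" "p' + n' < p + n"
  shows "gauss_integral p n < gauss_integral p' n'"
proof (cases "p' \<le> p")
  case True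
  then show ?thesis using assms by (intro gauss_integral_strict_antimono) auto
next
  \<comment> \<open>Now \<open>p < p'\<close> and \<open>n' < n\<close>: the primed pair is the more
    widely spread one. The integrands themselves need not be ordered, but their symmetrised sums
    are.\<close>
  case False
  let ?g = "\<lambda>p n t. 1 / sqrt (p * (cos t)\<^sup>2 + n * (sin t)\<^sup>2)"
  have pp: "0 < p" "0 < n" "0 < p'" using assms by auto
  have sym: "2 * gauss_integral p n = integral {0..pi/2} (\<lambda>t. ?g p n t + ?g n p t)"
    if "0 < p" "0 < n" for p n
  proof -
    have "integral {0..pi/2} (\<lambda>t. ?g p n t + ?g n p t) = gauss_integral p n + gauss_integral n p"
      unfolding gauss_integral_def
      by (intro Henstock_Kurzweil_Integration.integral_add integrable_continuous_interval
          gauss_integrand_continuous that)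
    then show ?thesis using gauss_integral_commute[OF that] by simp
  qed
  have "integral {0..pi/2} (\<lambda>t. ?g p n t + ?g n p t) < integral {0..pi/2} (\<lambda>t. ?g p' n' t + ?g n' p' t)"
  proof (rule integral_less_real)
    fix t assume "t \<in> {0<..<pi/2}"
    define z where "z = cos (2*t)"
    have z: "\<bar>z\<bar> \<le> 1" by (simp add: z_def)
    have c2: "(cos t)\<^sup>2 = (1 + z)/2" by (simp add: z_def cos_double_cos)
    have s2: "(sin t)\<^sup>2 = (1 - z)/2" by (simp add: z_def cos_double_sin)
    define A A' D D' where "A = (p + n)/2" and "A' = (p' + n')/2" and "D = (p - n)/2 * z"
      and "D' = (p' - n')/2 * z"
    have rep: "p * (cos t)\<^sup>2 + n * (sin t)\<^sup>2 = A + D" "n * (cos t)\<^sup>2 + p * (sin t)\<^sup>2 = A - D"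
      "p' * (cos t)\<^sup>2 + n' * (sin t)\<^sup>2 = A' + D'" "n' * (cos t)\<^sup>2 + p' * (sin t)\<^sup>2 = A' - D'"
      by (simp_all add: c2 s2 A_def A'_def D_def D'_def field_simps)
    have posAD: "0 < A + D" "0 < A - D" "0 < A' + D'" "0 < A' - D'"
      using gauss_radicand_pos pp pos(1) by (metis rep)+
    have AA: "A' < A" using less by (simp add: A_def A'_def)
    have "\<bar>(p - n)/2\<bar> \<le> \<bar>(p' - n')/2\<bar>" using False less pos by auto
    then have "\<bar>D\<bar> \<le> \<bar>D'\<bar>"
      unfolding D_def D'_def abs_mult by (rule mult_right_mono) simp
    then have DD: "D\<^sup>2 \<le> D'\<^sup>2" by (rule abs_le_square_iff[THEN iffD1])
    \<comment> \<open>The comparison passes through the mixed pair \<open>A + D'\<close>,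
      \<open>A - D'\<close>. First the mean is kept and the spread grows, which lowers the product;
      then the mean drops from \<open>A\<close> to \<open>A'\<close> at fixed spread.\<close>
    have "1 / sqrt (A + D) + 1 / sqrt (A - D) \<le> 1 / sqrt (A + D') + 1 / sqrt (A - D')"
      by (rule sum_inverse_sqrt_mono)
         (use posAD AA DD in \<open>auto simp: algebra_simps power2_eq_square\<close>)
    also have "\<dots> < 1 / sqrt (A' + D') + 1 / sqrt (A' - D')"
      using posAD AA by (intro add_strict_mono divide_strict_left_mono) auto
    finally show "?g p n t + ?g n p t < ?g p' n' t + ?g n' p' t"
      by (simp only: rep)
  qed (use pp pos pi_gt_zero in \<open>auto intro!: continuous_on_add gauss_integrand_continuous simp del: pi_gt_zero\<close>)
  then show ?thesis using sym[OF pp(1,2)] sym[OF pp(3) pos(1)] by linarith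
qed

text \<open>From \<open>cos t \<le> pi/2 - t\<close>, \<open>\<bar>sin t\<bar> \<le> 1\<close> and
  subadditivity of the root, the integrand dominates
  \<open>1 / (sqrt q * (pi/2 - t) + sqrt n)\<close>, whose primitive is a logarithm. The bound blows
  up as \<open>n\<close> tends to 0 while \<open>p\<close> stays below a fixed
  \<open>q\<close>.\<close>

lemma gauss_integral_log_lower_bound:
  assumes "0 < p" "p \<le> q" "0 < n"
  shows "(ln (sqrt q * (pi/2)) - ln (sqrt n)) / sqrt q \<le> gauss_integral p n"
proof -
  have q: "0 < q" using assms by simp
  let ?G = "\<lambda>t. - ln (sqrt q * (pi/2 - t) + sqrt n) / sqrt q"
  let ?l = "\<lambda>t. 1 / (sqrt q * (pi/2 - t) + sqrt n)"
  have pos: "0 < sqrt q * (pi/2 - t) + sqrt n" if "t \<le> pi/2" for t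
    using that q assms by (intro add_nonneg_pos) auto
  have int: "(?l has_integral ?G (pi/2) - ?G 0) {0..pi/2}"
  proof (rule fundamental_theorem_of_calculus)
    fix t assume t: "t \<in> {0..pi/2}"
    have "(?G has_real_derivative ?l t) (at t within {0..pi/2})"
      by (rule derivative_eq_intros refl | use pos[of t] t q in force)+
    then show "(?G has_vector_derivative ?l t) (at t within {0..pi/2})"
      by (simp add: has_real_derivative_iff_has_vector_derivative)
  qed simp
  have "(ln (sqrt q * (pi/2)) - ln (sqrt n)) / sqrt q \<le> ?G (pi/2) - ?G 0"
  proof -
    have "ln (sqrt q * (pi/2)) \<le> ln (sqrt q * (pi/2) + sqrt n)"
      using q assms by (intro ln_mono) (auto intro: add_nonneg_pos)
    then show ?thesis using q by (simp add: divide_simps)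
  qed
  also have "\<dots> = integral {0..pi/2} ?l" using int by (simp add: integral_unique)
  also have "\<dots> \<le> gauss_integral p n"
    unfolding gauss_integral_def
  proof (rule integral_le)
    show "?l integrable_on {0..pi/2}" using int by blast
    show "(\<lambda>t. 1 / sqrt (p * (cos t)\<^sup>2 + n * (sin t)\<^sup>2)) integrable_on {0..pi/2}"
      by (intro integrable_continuous_interval gauss_integrand_continuous assms)
    fix t assume t: "t \<in> {0..pi/2}"
    have "0 \<le> cos t" using t by (intro cos_ge_zero) auto
    moreover have "cos t \<le> pi/2 - t"
      using sin_x_le_x[of "pi/2 - t"] t by (simp add: sin_diff)
    ultimately have "p * (cos t)\<^sup>2 \<le> q * (pi/2 - t)\<^sup>2"
      using assms by (intro mult_mono power_mono) auto
    moreover have "n * (sin t)\<^sup>2 \<le> n * 1"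
      using assms by (intro mult_left_mono) (auto simp: abs_square_le_1)
    moreover have "(sqrt q * (pi/2 - t) + sqrt n)\<^sup>2 = q * (pi/2 - t)\<^sup>2 + n + 2 * (sqrt q * (pi/2 - t) * sqrt n)"
      using q assms by (simp add: power2_sum power_mult_distrib)
    moreover have "0 \<le> sqrt q * (pi/2 - t) * sqrt n" using q assms t by simp
    ultimately have "p * (cos t)\<^sup>2 + n * (sin t)\<^sup>2 \<le> (sqrt q * (pi/2 - t) + sqrt n)\<^sup>2"
      by linarith
    then have "sqrt (p * (cos t)\<^sup>2 + n * (sin t)\<^sup>2) \<le> sqrt q * (pi/2 - t) + sqrt n"
      using pos[of t] t by (intro real_le_lsqrt) auto
    then show "?l t \<le> 1 / sqrt (p * (cos t)\<^sup>2 + n * (sin t)\<^sup>2)"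
      using gauss_radicand_pos[OF assms(1,3), of t] pos[of t] t
      by (intro divide_left_mono) auto
  qed
  finally show ?thesis .
qed

section \<open>Admissible parameters and the ordering of the roots\<close>

locale wave_parameters =
  fixes \<omega> c :: real
  assumes admissible: "\<omega> > c\<^sup>2 / 4 \<or> (\<omega> = c\<^sup>2 / 4 \<and> c > 0)"
begin

lemma omega_pos: "0 < \<omega>"
proof -
  have "0 < c\<^sup>2" if "0 < c" using that by simp
  then show ?thesis using admissible zero_le_power2[of c] by argo
qed

lemma c_sq_le: "c\<^sup>2 \<le> 4 * \<omega>"
  using admissible by auto

text \<open>Equality \<open>c = 2 * sqrt \<omega>\<close> is the algebraic soliton and stays
  allowed; at the opposite end the sign condition on \<open>c\<close> makes the inequality
  strict.\<close>

lemma sqrt_omega: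
  "0 < sqrt \<omega>" "(sqrt \<omega>)\<^sup>2 = \<omega>" "c \<le> 2 * sqrt \<omega>" "- 2 * sqrt \<omega> < c"
proof -
  show pos: "0 < sqrt \<omega>" and sq: "(sqrt \<omega>)\<^sup>2 = \<omega>" using omega_pos by auto
  have "\<bar>c\<bar> \<le> 2 * sqrt \<omega>"
    by (rule power2_le_imp_le) (use c_sq_le pos in \<open>simp_all only: power_mult_distrib sq power2_abs, simp_all\<close>)
  then show "c \<le> 2 * sqrt \<omega>" by simp
  have "c \<noteq> - 2 * sqrt \<omega>"
  proof
    assume "c = - 2 * sqrt \<omega>"
    then have "c\<^sup>2 = 4 * \<omega>" "c < 0" using sq pos by (auto simp: power_mult_distrib)
    then show False using admissible by auto
  qed
  then show "- 2 * sqrt \<omega> < c" using \<open>\<bar>c\<bar> \<le> 2 * sqrt \<omega>\<close> by auto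
qed

lemma alpha0_pos: "0 < alpha0 \<omega> c"
  and alpha0_gt: "2 * c < alpha0 \<omega> c"
proof -
  have "\<bar>4 * c\<bar> \<le> sqrt (48*\<omega> + 4*c\<^sup>2)"
    using c_sq_le by (intro real_le_rsqrt) (simp add: power_mult_distrib)
  moreover have "- (4 * c) < sqrt (48*\<omega> + 4*c\<^sup>2)"
  proof (cases "c < 0")
    case True
    then have "c\<^sup>2 < 4 * \<omega>" using admissible by auto
    then show ?thesis by (intro real_less_rsqrt) (simp add: power_mult_distrib)
  next
    case False
    have "0 < sqrt (48*\<omega> + 4*c\<^sup>2)" using omega_pos by (simp add: add_pos_nonneg)
    then show ?thesis using False by linarith
  qed
  ultimately show "0 < alpha0 \<omega> c" "2 * c < alpha0 \<omega> c"
    by (auto simp: alpha0_def field_simps)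
qed

lemma alpha0_less_alpha1: "alpha0 \<omega> c < alpha1 \<omega> c"
proof -
  \<comment> \<open>This product is the difference of the squares of the two quantities compared
    below, so the claim rests on \<open>- 2 * sqrt \<omega> < c\<close>.\<close>
  have "0 < 48 * (sqrt \<omega> * (2 * sqrt \<omega> + c))" using sqrt_omega by (intro mult_pos_pos) auto
  also have "\<dots> = (12 * sqrt \<omega> + 2 * c)\<^sup>2 - (48*(sqrt \<omega>)\<^sup>2 + 4*c\<^sup>2)"
    by (simp only: power2_eq_square) (simp add: algebra_simps)
  finally have "48*\<omega> + 4*c\<^sup>2 < (12 * sqrt \<omega> + 2 * c)\<^sup>2"
    unfolding sqrt_omega(2) by simp
  then have "sqrt (48*\<omega> + 4*c\<^sup>2) < 12 * sqrt \<omega> + 2 * c"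
    using sqrt_omega by (intro real_less_lsqrt) auto
  then show ?thesis by (simp add: alpha0_def alpha1_def field_simps)
qed

text \<open>The third expression is \<open>- eta1 * eta2\<close> and vanishes at
  \<open>alpha1\<close>. The fourth has \<open>alpha0\<close> as its larger root and decides whether
  \<open>eta2\<close> lies below \<open>e\<close>; the last fixes the sign needed when that
  comparison is squared.\<close>

lemma interval_facts:
  assumes "alpha0 \<omega> c < e" "e < alpha1 \<omega> c"
  shows "0 < e" "2 * c < e" "0 < 16 * \<omega> - (e - 2*c)\<^sup>2" "0 < 3*e\<^sup>2 - 8*c*e + 4*c\<^sup>2 - 16*\<omega>" "4 * c < 3 * e"
proof -
  show "0 < e" "2 * c < e" using assms alpha0_pos alpha0_gt by auto
  have "(e - 2*c)\<^sup>2 < (4 * sqrt \<omega>)\<^sup>2"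
    using assms \<open>2 * c < e\<close> by (intro power_strict_mono) (auto simp: alpha1_def)
  then show "0 < 16 * \<omega> - (e - 2*c)\<^sup>2" by (simp add: power_mult_distrib sqrt_omega(2))
  have r: "sqrt (48*\<omega> + 4*c\<^sup>2) < 3*e - 4*c" using assms by (simp add: alpha0_def field_simps)
  then have "(sqrt (48*\<omega> + 4*c\<^sup>2))\<^sup>2 < (3*e - 4*c)\<^sup>2"
    using omega_pos by (intro power_strict_mono) auto
  then show "0 < 3*e\<^sup>2 - 8*c*e + 4*c\<^sup>2 - 16*\<omega>"
    using omega_pos by (simp add: power2_eq_square algebra_simps)
  have "0 \<le> sqrt (48*\<omega> + 4*c\<^sup>2)" using omega_pos by simp
  then show "4 * c < 3 * e" using r by linarith
qed

lemma Apol_pos: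
  assumes "alpha0 \<omega> c < e" "e < alpha1 \<omega> c"
  shows "0 < Apol \<omega> c e"
proof -
  have "Apol \<omega> c e = (4*c - e)\<^sup>2 + 4 * (16 * \<omega> - (e - 2*c)\<^sup>2)"
    by (simp add: Apol_def power2_eq_square algebra_simps)
  then show ?thesis using interval_facts(3)[OF assms] by (simp add: add_nonneg_pos)
qed

lemma eta_order:
  assumes "alpha0 \<omega> c < e" "e < alpha1 \<omega> c"
  shows "eta1 \<omega> c e < 0" "0 < eta2 \<omega> c e" "eta2 \<omega> c e < e"
proof -
  note F = interval_facts[OF assms]
  have "(4*c - e)\<^sup>2 < Apol \<omega> c e"
    using F(3) by (simp add: Apol_def power2_eq_square algebra_simps)
  then have "\<bar>4*c - e\<bar> < sqrt (Apol \<omega> c e)" by (intro real_less_rsqrt) simp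
  then show "eta1 \<omega> c e < 0" "0 < eta2 \<omega> c e" by (auto simp: eta1_def eta2_def)
  have "Apol \<omega> c e < (3*e - 4*c)\<^sup>2"
    using F(4) by (simp add: Apol_def power2_eq_square algebra_simps)
  then have "sqrt (Apol \<omega> c e) < 3*e - 4*c"
    using F(5) by (intro real_less_lsqrt) auto
  then show "eta2 \<omega> c e < e" by (simp add: eta2_def)
qed

text \<open>This and the next lemma are Vieta relations. They later express \<open>c\<close> and
  \<open>\<omega>\<close> through the three roots when the profile equation is verified.\<close>

lemma eta_sum: "eta1 \<omega> c e + eta2 \<omega> c e + e = 4 * c"
  by (simp add: eta1_def eta2_def field_simps)

lemma eta_pair_sum:
  assumes "0 \<le> Apol \<omega> c e"
  shows "eta1 \<omega> c e * eta2 \<omega> c e + e * (eta1 \<omega> c e + eta2 \<omega> c e) = 4 * c\<^sup>2 - 16 * \<omega>"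
proof -
  have "(sqrt (Apol \<omega> c e))\<^sup>2 = Apol \<omega> c e" using assms by simp
  then show ?thesis
    by (simp add: eta1_def eta2_def Apol_def power2_eq_square field_simps)
qed

section \<open>The period as Gauss's integral, and its inversion\<close>

definition Ppar :: "real \<Rightarrow> real" where
  "Ppar e = e * (eta2 \<omega> c e - eta1 \<omega> c e)"

text \<open>On the interval, \<open>Ppar e\<close> is \<open>(2 / g)\<^sup>2\<close> and
  \<open>Npar e\<close> is \<open>Ppar e * (1 - k\<^sup>2)\<close>, the complementary modulus on the
  same scale.\<close>

definition Npar :: "real \<Rightarrow> real" where
  "Npar e = eta2 \<omega> c e * (e - eta1 \<omega> c e)"

lemma Ppar_eq: "Ppar e = e * sqrt (Apol \<omega> c e)"
  by (simp add: Ppar_def eta1_def eta2_def field_simps)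

lemma Npar_eq:
  assumes "0 \<le> Apol \<omega> c e"
  shows "Npar e = (e * sqrt (Apol \<omega> c e) + (-3*e\<^sup>2 + 12*c*e + 32*\<omega> - 8*c\<^sup>2)) / 2"
proof -
  have "(sqrt (Apol \<omega> c e))\<^sup>2 = Apol \<omega> c e" using assms by simp
  then show ?thesis
    by (simp add: Npar_def eta1_def eta2_def Apol_def power2_eq_square field_simps)
qed

lemma par_pos:
  assumes "alpha0 \<omega> c < e" "e < alpha1 \<omega> c"
  shows "0 < Npar e" "Npar e < Ppar e"
proof -
  note O = eta_order[OF assms] and F = interval_facts[OF assms]
  show "0 < Npar e" using O F by (simp add: Npar_def)
  have "Ppar e - Npar e = - eta1 \<omega> c e * (e - eta2 \<omega> c e)"
    by (simp add: Ppar_def Npar_def algebra_simps)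
  also have "\<dots> > 0" using O by (intro mult_pos_pos) auto
  finally show "Npar e < Ppar e" by simp
qed

lemma ksq_eq:
  assumes "alpha0 \<omega> c < e" "e < alpha1 \<omega> c"
  shows "ksq \<omega> c e = 1 - Npar e / Ppar e"
proof -
  have "ksq \<omega> c e = (Ppar e - Npar e) / Ppar e"
    unfolding ksq_def Ppar_def[symmetric] by (simp add: Ppar_def Npar_def algebra_simps)
  then show ?thesis using par_pos[OF assms] by (simp add: diff_divide_distrib)
qed

lemma kmod_sq:
  assumes "alpha0 \<omega> c < e" "e < alpha1 \<omega> c"
  shows "(kmod \<omega> c e)\<^sup>2 = ksq \<omega> c e" "(kmod \<omega> c e)\<^sup>2 < 1"
  using par_pos[OF assms] by (auto simp: kmod_def ksq_eq[OF assms])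

text \<open>The prefactor \<open>g = 2 / sqrt (Ppar e)\<close> is moved under the root, where
  \<open>P * (1 - k\<^sup>2 * (sin t)\<^sup>2) = P * (cos t)\<^sup>2 + N * (sin
  t)\<^sup>2\<close>.\<close>

lemma Tper_eq:
  assumes "alpha0 \<omega> c < e" "e < alpha1 \<omega> c"
  shows "Tper \<omega> c e = 8 * gauss_integral (Ppar e) (Npar e)"
proof -
  note pp = par_pos[OF assms]
  have "2 / sqrt (Ppar e) * (1 / sqrt (1 - ksq \<omega> c e * (sin t)\<^sup>2))
         = 2 * (1 / sqrt (Ppar e * (cos t)\<^sup>2 + Npar e * (sin t)\<^sup>2))" for t
  proof -
    have "Ppar e * (1 - ksq \<omega> c e * (sin t)\<^sup>2) = Ppar e * (cos t)\<^sup>2 + Npar e * (sin t)\<^sup>2"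
      using pp by (simp add: ksq_eq[OF assms] cos_squared_eq field_simps)
    then show ?thesis by (metis (no_types) mult_numeral_1_right numeral_One real_sqrt_mult
        times_divide_times_eq times_divide_eq_right)
  qed
  then have "2 / sqrt (Ppar e) * ellK (kmod \<omega> c e) = 2 * gauss_integral (Ppar e) (Npar e)"
    unfolding ellK_def gauss_integral_def kmod_sq(1)[OF assms]
    by (simp only: integral_mult_right[symmetric])
  then show ?thesis by (simp add: Tper_def gpar_def Ppar_def[symmetric])
qed

text \<open>The left side is half the derivative of \<open>Ppar\<close>, and the inequality says
  exactly that \<open>Ppar + Npar\<close> has negative derivative.\<close>

lemma par_derivative_sign:
  assumes "alpha0 \<omega> c < e" "e < alpha1 \<omega> c"
  shows "(-3*e\<^sup>2 + 6*c*e + 32*\<omega>) / sqrt (Apol \<omega> c e) < e - 2*c"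
proof -
  note F = interval_facts[OF assms] and A = Apol_pos[OF assms]
  let ?X = "-3*e\<^sup>2 + 6*c*e + 32*\<omega>" and ?Y = "(e - 2*c) * sqrt (Apol \<omega> c e)"
  have Y: "0 < ?Y" using F A by simp
  have "?X < ?Y"
  proof (cases "?X \<le> 0")
    case False
    \<comment> \<open>Three times this factor is \<open>?X + 16 * \<omega>\<close>, hence positive
      together with \<open>?X\<close>.\<close>
    then have "0 < 16*\<omega> + 2*c*e - e\<^sup>2" using omega_pos by simp
    have Y2: "?Y\<^sup>2 = (e - 2*c)\<^sup>2 * Apol \<omega> c e" using A by (simp add: power_mult_distrib)
    \<comment> \<open>Squaring removes the root in \<open>?Y\<close>; the difference then factors,
      and the first factor is positive to the right of \<open>alpha0\<close>.\<close>
    have "?Y\<^sup>2 - ?X\<^sup>2 = 4 * ((3*e\<^sup>2 - 8*c*e + 4*c\<^sup>2 - 16*\<omega>) * (16*\<omega> + 2*c*e - e\<^sup>2))"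
      unfolding Y2 unfolding Apol_def by (simp add: power2_eq_square algebra_simps)
    also have "\<dots> > 0" using F(4) \<open>0 < 16*\<omega> + 2*c*e - e\<^sup>2\<close> by simp
    finally have "?X\<^sup>2 < ?Y\<^sup>2" by simp
    then show ?thesis by (rule power2_less_imp_less) (use Y in simp)
  qed (use Y in linarith)
  then show ?thesis using A by (simp add: divide_less_eq)
qed

lemma par_has_derivative:
  assumes "alpha0 \<omega> c < e" "e < alpha1 \<omega> c"
  defines "d \<equiv> (-3*e\<^sup>2 + 6*c*e + 32*\<omega>) / sqrt (Apol \<omega> c e)"
  shows "(Ppar has_real_derivative 2 * d) (at e)"
    and "(Npar has_real_derivative d - 3 * (e - 2*c)) (at e)"
proof -
  note A = Apol_pos[OF assms(1,2)]
  let ?S = "{alpha0 \<omega> c<..<alpha1 \<omega> c}"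
  have dA: "((\<lambda>e. Apol \<omega> c e) has_real_derivative -6*e + 8*c) (at e)"
    unfolding Apol_def by (auto intro!: derivative_eq_intros)
  have dS: "((\<lambda>e. sqrt (Apol \<omega> c e)) has_real_derivative
      inverse (sqrt (Apol \<omega> c e)) / 2 * (-6*e + 8*c)) (at e)"
    by (rule DERIV_chain2[OF DERIV_real_sqrt[OF A] dA])
  have d1: "((\<lambda>e. e * sqrt (Apol \<omega> c e)) has_real_derivative 2 * d) (at e)"
  proof (rule DERIV_cong[OF DERIV_mult[OF DERIV_ident dS]])
    define s where "s = sqrt (Apol \<omega> c e)"
    have s: "0 < s" "s * s = -3*e\<^sup>2 + 8*c*e + 64*\<omega>" using A by (auto simp: s_def Apol_def)
    have "1 * s + inverse s / 2 * (- 6 * e + 8 * c) * e = (s * s + (- 6 * e + 8 * c) * e / 2) / s"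
      using s(1) by (simp add: divide_simps)
    also have "s * s + (- 6 * e + 8 * c) * e / 2 = 2 * (-3*e\<^sup>2 + 6*c*e + 32*\<omega>)"
      unfolding s(2) by (simp add: power2_eq_square field_simps)
    finally show "1 * sqrt (Apol \<omega> c e) + inverse (sqrt (Apol \<omega> c e)) / 2 * (- 6 * e + 8 * c) * e = 2 * d"
      unfolding d_def s_def[symmetric] by simp
  qed
  then show "(Ppar has_real_derivative 2 * d) (at e)"
    by (simp add: Ppar_eq[abs_def])
  have dB: "((\<lambda>e. -3*e\<^sup>2 + 12*c*e + 32*\<omega> - 8*c\<^sup>2) has_real_derivative -6*e + 12*c) (at e)"
    by (auto intro!: derivative_eq_intros)
  have "((\<lambda>e. (e * sqrt (Apol \<omega> c e) + (-3*e\<^sup>2 + 12*c*e + 32*\<omega> - 8*c\<^sup>2)) / 2)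
      has_real_derivative d - 3 * (e - 2*c)) (at e)"
    by (rule DERIV_cong[OF DERIV_cdivide[OF DERIV_add[OF d1 dB]]]) (simp add: field_simps)
  \<comment> \<open>\<open>Npar_eq\<close> holds where \<open>Apol\<close> is nonnegative, so the
    derivative is transferred within the open interval.\<close>
  then show "(Npar has_real_derivative d - 3 * (e - 2*c)) (at e)"
    by (rule has_field_derivative_transform_within_open[of _ _ _ ?S])
       (use assms(1,2) Apol_pos in \<open>auto simp: Npar_eq less_imp_le\<close>)
qed

lemma Tper_strict_mono:
  assumes "alpha0 \<omega> c < e" "e < e'" "e' < alpha1 \<omega> c"
  shows "Tper \<omega> c e < Tper \<omega> c e'"
proof -
  have "Npar e' < Npar e"
  proof (rule DERIV_neg_imp_decreasing[OF assms(2)])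
    fix x assume "e \<le> x" "x \<le> e'"
    then have x: "alpha0 \<omega> c < x" "x < alpha1 \<omega> c" using assms by auto
    define d where "d = (-3*x\<^sup>2 + 6*c*x + 32*\<omega>) / sqrt (Apol \<omega> c x)"
    \<comment> \<open>Split as \<open>(d - (x - 2*c)) - 2 * (x - 2*c)\<close>, both parts are
      negative.\<close>
    have "d - 3 * (x - 2*c) < 0"
      using par_derivative_sign[OF x, folded d_def] interval_facts(2)[OF x] by argo
    with par_has_derivative(2)[OF x, folded d_def] show "\<exists>y. (Npar has_real_derivative y) (at x) \<and> y < 0"
      by blast
  qed
  moreover have "Ppar e' + Npar e' < Ppar e + Npar e"
  proof (rule DERIV_neg_imp_decreasing[OF assms(2)])
    fix x assume "e \<le> x" "x \<le> e'"
    then have x: "alpha0 \<omega> c < x" "x < alpha1 \<omega> c" using assms by auto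
    define d where "d = (-3*x\<^sup>2 + 6*c*x + 32*\<omega>) / sqrt (Apol \<omega> c x)"
    \<comment> \<open>The sum is \<open>3 * (d - (x - 2*c))\<close>.\<close>
    have "2 * d + (d - 3 * (x - 2*c)) < 0"
      using par_derivative_sign[OF x, folded d_def] by argo
    with DERIV_add[OF par_has_derivative[OF x, folded d_def]]
    show "\<exists>y. ((\<lambda>x. Ppar x + Npar x) has_real_derivative y) (at x) \<and> y < 0"
      by blast
  qed
  ultimately show ?thesis
    using assms par_pos[of e] par_pos[of e'] Tper_eq[of e] Tper_eq[of e']
    by (auto intro!: gauss_integral_less)
qed

lemma Tper_continuous_on: "continuous_on {alpha0 \<omega> c<..<alpha1 \<omega> c} (Tper \<omega> c)"
proof -
  let ?S = "{alpha0 \<omega> c<..<alpha1 \<omega> c}"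
  let ?f = "\<lambda>e t. 1 / sqrt (Ppar e * (cos t)\<^sup>2 + Npar e * (sin t)\<^sup>2)"
  have "continuous_on ?S Ppar" "continuous_on ?S Npar"
    using par_has_derivative by (auto intro!: continuous_at_imp_continuous_on DERIV_isCont)
  then have PN: "continuous_on (?S \<times> cbox 0 (pi/2)) (\<lambda>z. Ppar (fst z))"
    "continuous_on (?S \<times> cbox 0 (pi/2)) (\<lambda>z. Npar (fst z))"
    by (auto elim!: continuous_on_compose2 intro!: continuous_on_fst continuous_on_id)
  have "Ppar (fst z) * (cos (snd z))\<^sup>2 + Npar (fst z) * (sin (snd z))\<^sup>2 \<noteq> 0"
    if "z \<in> ?S \<times> cbox 0 (pi/2)" for z
    using gauss_radicand_pos[of "Ppar (fst z)" "Npar (fst z)" "snd z"] par_pos[of "fst z"] that by auto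
  then have "continuous_on (?S \<times> cbox 0 (pi/2)) (\<lambda>z. ?f (fst z) (snd z))"
    by (intro continuous_intros PN) auto
  then have "continuous_on ?S (\<lambda>e. integral (cbox 0 (pi/2)) (?f e))"
    by (intro integral_continuous_on_param) (simp add: case_prod_unfold)
  then have "continuous_on ?S (\<lambda>e. 8 * gauss_integral (Ppar e) (Npar e))"
    unfolding gauss_integral_def by (intro continuous_intros) simp
  then show ?thesis
    by (rule continuous_on_eq) (simp add: Tper_eq)
qed

lemma Tper_unbounded:
  obtains e where "alpha0 \<omega> c < e" "e < alpha1 \<omega> c" "z < Tper \<omega> c e"
proof -
  let ?F = "at_left (alpha1 \<omega> c)"
  define q where "q = Ppar (alpha1 \<omega> c) + 1"
  \<comment> \<open>The value of \<open>\<delta>\<close> at which the logarithmic lower bound, with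
    \<open>sqrt n = \<delta>\<close>, equals \<open>\<bar>z\<bar> + 1\<close>. The constant
    \<open>q\<close> bounds \<open>Ppar\<close> near \<open>alpha1\<close>.\<close>
  define \<delta> where "\<delta> = exp (ln (sqrt q * (pi/2)) - sqrt q * (\<bar>z\<bar> + 1))"
  have Npar1: "Npar (alpha1 \<omega> c) = 0"
  proof -
    \<comment> \<open>At the right end \<open>Apol\<close> is a perfect square, with nonnegative
      base because \<open>c \<le> 2 * sqrt \<omega>\<close>; this makes \<open>eta2\<close> vanish
      there.\<close>
    have "Apol \<omega> c (alpha1 \<omega> c) = (4 * sqrt \<omega> - 2*c)\<^sup>2"
      using sqrt_omega(2) by (simp add: Apol_def alpha1_def power2_eq_square algebra_simps)
    then have "sqrt (Apol \<omega> c (alpha1 \<omega> c)) = 4 * sqrt \<omega> - 2*c"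
      using sqrt_omega by simp
    then show ?thesis by (simp add: Npar_def eta2_def alpha1_def)
  qed
  have "isCont Ppar (alpha1 \<omega> c)" "isCont Npar (alpha1 \<omega> c)"
    unfolding Ppar_def Npar_def eta1_def eta2_def Apol_def by (intro continuous_intros; simp)+
  then have "(Ppar \<longlongrightarrow> Ppar (alpha1 \<omega> c)) ?F" "(Npar \<longlongrightarrow> 0) ?F"
    using Npar1 by (auto simp: isCont_def intro: tendsto_within_subset)
  then have "\<forall>\<^sub>F e in ?F. Ppar e < q" "\<forall>\<^sub>F e in ?F. Npar e < \<delta>\<^sup>2"
    by (auto intro!: order_tendstoD simp: q_def \<delta>_def)
  moreover have "\<forall>\<^sub>F e in ?F. e \<in> {alpha0 \<omega> c<..<alpha1 \<omega> c}"
    by (rule eventually_at_leftI[OF _ alpha0_less_alpha1]) auto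
  ultimately have "\<forall>\<^sub>F e in ?F. e \<in> {alpha0 \<omega> c<..<alpha1 \<omega> c} \<and> Ppar e < q \<and> Npar e < \<delta>\<^sup>2"
    by eventually_elim auto
  then obtain e where e: "alpha0 \<omega> c < e" "e < alpha1 \<omega> c" "Ppar e < q" "Npar e < \<delta>\<^sup>2"
    using eventually_happens' trivial_limit_at_left_real by fastforce
  note pp = par_pos[OF e(1,2)]
  have q: "0 < q" using e pp by simp
  have "sqrt (Npar e) < \<delta>"
    using e(4) by (intro real_less_lsqrt) (auto simp: \<delta>_def)
  then have "ln (sqrt (Npar e)) < ln (sqrt q * (pi/2)) - sqrt q * (\<bar>z\<bar> + 1)"
    using pp(1) by (metis \<delta>_def ln_exp ln_less_cancel_iff exp_gt_zero real_sqrt_gt_zero)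
  then have "\<bar>z\<bar> + 1 < (ln (sqrt q * (pi/2)) - ln (sqrt (Npar e))) / sqrt q"
    using q by (simp add: less_divide_eq mult.commute)
  also have "\<dots> \<le> gauss_integral (Ppar e) (Npar e)"
    using pp e by (intro gauss_integral_log_lower_bound) auto
  finally have "z < Tper \<omega> c e" by (simp add: Tper_eq[OF e(1,2)])
  with e show ?thesis using that by blast
qed

text \<open>Any \<open>e\<close> with period below \<open>2 * L\<close> serves as left end for the
  intermediate value theorem, while divergence of the period supplies the right end. The bound
  \<open>e < eta3L\<close> is what drives the limit below.\<close>

lemma eta3L_properties:
  assumes e: "alpha0 \<omega> c < e" "e < alpha1 \<omega> c" and L: "Tper \<omega> c e < 2 * L"
  shows "e < eta3L \<omega> c L" "eta3L \<omega> c L < alpha1 \<omega> c" "Tper \<omega> c (eta3L \<omega> c L) = 2 * L"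
proof -
  obtain e1 where e1: "alpha0 \<omega> c < e1" "e1 < alpha1 \<omega> c" "2 * L < Tper \<omega> c e1"
    by (rule Tper_unbounded)
  have "e < e1"
    using Tper_strict_mono[of e1 e] e e1 L by (cases e e1 rule: linorder_cases) auto
  then have "\<exists>x\<ge>e. x \<le> e1 \<and> Tper \<omega> c x = 2 * L"
    using e e1 L by (intro IVT' continuous_on_subset[OF Tper_continuous_on]) auto
  then obtain x where x: "e \<le> x" "x \<le> e1" "Tper \<omega> c x = 2 * L" by auto
  have ex: "e < x" using x L by (cases "e = x") auto
  have "eta3L \<omega> c L = x"
    unfolding eta3L_def
  proof (rule the_equality)
    show "alpha0 \<omega> c < x \<and> x < alpha1 \<omega> c \<and> Tper \<omega> c x = 2 * L" using x e e1 by auto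
    fix y assume "alpha0 \<omega> c < y \<and> y < alpha1 \<omega> c \<and> Tper \<omega> c y = 2 * L"
    then show "y = x"
      using Tper_strict_mono[of x y] Tper_strict_mono[of y x] x e e1 by (cases x y rule: linorder_cases) auto
  qed
  then show "e < eta3L \<omega> c L" "eta3L \<omega> c L < alpha1 \<omega> c" "Tper \<omega> c (eta3L \<omega> c L) = 2 * L"
    using x ex e1 by auto
qed

lemma eventually_eta3L:
  "\<forall>\<^sub>F L in at_top. alpha0 \<omega> c < eta3L \<omega> c L \<and> eta3L \<omega> c L < alpha1 \<omega> c \<and> Tper \<omega> c (eta3L \<omega> c L) = 2 * L"
proof -
  obtain e where e: "alpha0 \<omega> c < e" "e < alpha1 \<omega> c" using dense[OF alpha0_less_alpha1] by blast
  show ?thesis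
    using eventually_gt_at_top[of "Tper \<omega> c e / 2"]
  proof eventually_elim
    case (elim L)
    then show ?case using eta3L_properties[OF e, of L] e by auto
  qed
qed

lemma eta3L_tendsto: "((\<lambda>L. eta3L \<omega> c L) \<longlongrightarrow> alpha1 \<omega> c) at_top"
proof (rule order_tendstoI)
  fix a assume "a < alpha1 \<omega> c"
  \<comment> \<open>Once \<open>2 * L\<close> exceeds the period at this \<open>e\<close>, the
    solution \<open>eta3L\<close> lies to the right of \<open>e\<close>, hence of
    \<open>a\<close>.\<close>
  then obtain e where e: "max a (alpha0 \<omega> c) < e" "e < alpha1 \<omega> c"
    using dense[of "max a (alpha0 \<omega> c)" "alpha1 \<omega> c"] alpha0_less_alpha1 by auto
  show "\<forall>\<^sub>F L in at_top. a < eta3L \<omega> c L"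
    using eventually_gt_at_top[of "Tper \<omega> c e / 2"]
  proof eventually_elim
    case (elim L)
    then show ?case using eta3L_properties[of e L] e by auto
  qed
next
  fix a assume "alpha1 \<omega> c < a"
  then show "\<forall>\<^sub>F L in at_top. eta3L \<omega> c L < a"
    using eventually_eta3L by (auto elim: eventually_mono)
qed

end

section \<open>The profile equation\<close>

definition wave_force :: "real \<Rightarrow> real \<Rightarrow> real \<Rightarrow> real" where
  "wave_force \<omega> c y = (\<omega> - c\<^sup>2/4) * y + c/2 * y^3 - 3/16 * y^5"

text \<open>Twice the primitive of \<open>wave_force\<close> that vanishes at 0, so that the
  conserved energy is \<open>v\<^sup>2\<close> minus the potential.\<close>

definition wave_potential :: "real \<Rightarrow> real \<Rightarrow> real \<Rightarrow> real" where
  "wave_potential \<omega> c y = (\<omega> - c\<^sup>2/4) * y\<^sup>2 + c/4 * y^4 - 1/16 * y^6"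

text \<open>The slope is a separate function: a wave is a trajectory \<open>(f, v)\<close> of a
  planar system, and both the stability estimate and the polynomials for higher derivatives act on
  this pair.\<close>

definition wave_solution :: "real \<Rightarrow> real \<Rightarrow> (real \<Rightarrow> real) \<Rightarrow> (real \<Rightarrow> real) \<Rightarrow> bool" where
  "wave_solution \<omega> c f v \<longleftrightarrow>
     (\<forall>x. (f has_real_derivative v x) (at x)) \<and>
     (\<forall>x. (v has_real_derivative wave_force \<omega> c (f x)) (at x))"

text \<open>The explicit waves are known through their squares; this form needs only
  \<open>y\<^sup>2\<close> besides one factor \<open>y\<close>.\<close>

lemma wave_force_factor:
  "wave_force \<omega> c y = y * ((\<omega> - c\<^sup>2/4) + c/2 * y\<^sup>2 - 3/16 * (y\<^sup>2)\<^sup>2)"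
  by (simp add: wave_force_def eval_nat_numeral algebra_simps)

lemma wave_solutionD:
  assumes "wave_solution \<omega> c f v"
  shows "(f has_real_derivative v x) (at x)"
    and "(v has_real_derivative wave_force \<omega> c (f x)) (at x)"
  using assms by (auto simp: wave_solution_def)

lemma wave_solution_energy:
  assumes sol: "wave_solution \<omega> c f v"
  shows "(v x)\<^sup>2 - wave_potential \<omega> c (f x) = (v y)\<^sup>2 - wave_potential \<omega> c (f y)"
proof -
  have "((\<lambda>x. (v x)\<^sup>2 - wave_potential \<omega> c (f x)) has_real_derivative 0) (at x)" for x
    unfolding wave_potential_def
    by (rule derivative_eq_intros wave_solutionD[OF sol] refl)+
       (simp add: wave_force_def algebra_simps power2_eq_square eval_nat_numeral)
  then show ?thesis by (intro DERIV_isconst_all) auto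
qed

lemma wave_force_lipschitz:
  fixes y z :: real
  assumes "\<bar>y\<bar> \<le> B" "\<bar>z\<bar> \<le> B"
  shows "\<bar>wave_force \<omega> c y - wave_force \<omega> c z\<bar>
          \<le> (\<bar>\<omega> - c\<^sup>2/4\<bar> + 3 * \<bar>c/2\<bar> * B\<^sup>2 + 15/16 * B^4) * \<bar>y - z\<bar>"
proof -
  have B: "0 \<le> B" using assms by linarith
  have m: "\<bar>y^i * z^j\<bar> \<le> B^(i+j)" for i j
    using B assms by (auto simp: abs_mult power_abs power_add intro!: mult_mono power_mono)
  \<comment> \<open>These are the divided differences of the cube and the fifth power. All exponents
    are spelled out so that the single bound \<open>m\<close> covers each monomial.\<close>
  let ?q2 = "y^2*z^0 + y^1*z^1 + y^0*z^2"
  let ?q4 = "y^4*z^0 + y^3*z^1 + y^2*z^2 + y^1*z^3 + y^0*z^4"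
  have q2: "\<bar>?q2\<bar> \<le> 3 * B\<^sup>2"
    using m[of 2 0] m[of 1 1] m[of 0 2]
    by (simp only: add_0 add_0_right one_add_one)
  have q4: "\<bar>?q4\<bar> \<le> 5 * B^4"
  proof -
    have *: "\<bar>u1 + u2 + u3 + u4 + u5\<bar> \<le> 5 * K"
      if "\<bar>u1\<bar> \<le> K" "\<bar>u2\<bar> \<le> K" "\<bar>u3\<bar> \<le> K" "\<bar>u4\<bar> \<le> K" "\<bar>u5\<bar> \<le> K" for u1 u2 u3 u4 u5 K :: real
      using that by linarith
    have **: "\<bar>y^i * z^j\<bar> \<le> B^4" if "i + j = 4" for i j using m[of i j] that by simp
    show ?thesis by (intro * **) simp_all
  qed
  have "wave_force \<omega> c y - wave_force \<omega> c z
         = (\<omega> - c\<^sup>2/4) * (y - z) + c/2 * (y^3 - z^3) - 3/16 * (y^5 - z^5)"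
    unfolding wave_force_def right_diff_distrib by linarith
  also have "y^3 - z^3 = ?q2 * (y - z)" by (simp add: eval_nat_numeral algebra_simps)
  also have "y^5 - z^5 = ?q4 * (y - z)" by (simp add: eval_nat_numeral algebra_simps)
  also have "(\<omega> - c\<^sup>2/4) * (y - z) + c/2 * (?q2 * (y - z)) - 3/16 * (?q4 * (y - z))
         = ((\<omega> - c\<^sup>2/4) + c/2 * ?q2 - 3/16 * ?q4) * (y - z)"
    by (simp only: distrib_right left_diff_distrib mult.assoc)
  finally have "wave_force \<omega> c y - wave_force \<omega> c z
         = ((\<omega> - c\<^sup>2/4) + c/2 * ?q2 - 3/16 * ?q4) * (y - z)" .
  then have "\<bar>wave_force \<omega> c y - wave_force \<omega> c z\<bar>
         = \<bar>(\<omega> - c\<^sup>2/4) + c/2 * ?q2 - 3/16 * ?q4\<bar> * \<bar>y - z\<bar>"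
    by (simp add: abs_mult)
  also have "\<dots> \<le> (\<bar>\<omega> - c\<^sup>2/4\<bar> + 3 * \<bar>c/2\<bar> * B\<^sup>2 + 15/16 * B^4) * \<bar>y - z\<bar>"
  proof (rule mult_right_mono)
    have "\<bar>c/2 * ?q2\<bar> \<le> \<bar>c/2\<bar> * (3 * B\<^sup>2)"
      unfolding abs_mult by (rule mult_left_mono[OF q2]) simp
    moreover have "\<bar>u + w - 3/16 * t\<bar> \<le> \<bar>u\<bar> + \<bar>w\<bar> + 3/16 * \<bar>t\<bar>" for u w t :: real
      by linarith
    note this[of "\<omega> - c\<^sup>2/4" "c/2 * ?q2" ?q4]
    ultimately show "\<bar>(\<omega> - c\<^sup>2/4) + c/2 * ?q2 - 3/16 * ?q4\<bar>
       \<le> \<bar>\<omega> - c\<^sup>2/4\<bar> + 3 * \<bar>c/2\<bar> * B\<^sup>2 + 15/16 * B^4"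
      using q4 by linarith
  qed simp
  finally show ?thesis .
qed

text \<open>Gronwall's argument for the squared distance \<open>E\<close>. In \<open>M\<close> the
  summand 1 comes from \<open>f' = v\<close> and the rest is the Lipschitz constant of the force;
  \<open>2 * \<bar>d\<bar> * \<bar>e\<bar> \<le> E\<close> then gives
  \<open>E' \<le> M * E\<close>.\<close>

lemma wave_solution_continuous_dependence:
  assumes f: "wave_solution \<omega> c f v" and h: "wave_solution \<omega> c h w"
    and bound: "\<And>t. 0 \<le> t \<Longrightarrow> t \<le> x \<Longrightarrow> \<bar>f t\<bar> \<le> B \<and> \<bar>h t\<bar> \<le> B"
    and "0 \<le> x"
    and M: "M = 1 + (\<bar>\<omega> - c\<^sup>2/4\<bar> + 3 * \<bar>c/2\<bar> * B\<^sup>2 + 15/16 * B^4)"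
  shows "(f x - h x)\<^sup>2 + (v x - w x)\<^sup>2 \<le> ((f 0 - h 0)\<^sup>2 + (v 0 - w 0)\<^sup>2) * exp (M * x)"
proof -
  define E where "E t = (f t - h t)\<^sup>2 + (v t - w t)\<^sup>2" for t
  have "E x * exp (- M * x) \<le> E 0 * exp (- M * 0)"
  proof (rule DERIV_nonpos_imp_nonincreasing[OF \<open>0 \<le> x\<close>])
    fix t assume t: "0 \<le> t" "t \<le> x"
    let ?d = "f t - h t" and ?e = "v t - w t"
      and ?p = "wave_force \<omega> c (f t) - wave_force \<omega> c (h t)"
    have der: "((\<lambda>t. E t * exp (- M * t)) has_real_derivative
        (2 * ?d * ?e + 2 * ?e * ?p - M * E t) * exp (- M * t)) (at t)"
      unfolding E_def
      by (rule derivative_eq_intros wave_solutionD[OF f] wave_solutionD[OF h] refl)+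
         (simp add: algebra_simps)
    have "\<bar>?p\<bar> \<le> (M - 1) * \<bar>?d\<bar>"
      using wave_force_lipschitz[of "f t" B "h t" \<omega> c] bound[OF t] M by simp
    then have "2 * (\<bar>?e\<bar> * \<bar>?p\<bar>) \<le> 2 * (\<bar>?e\<bar> * ((M - 1) * \<bar>?d\<bar>))"
      by (simp add: mult_left_mono)
    moreover have "2 * ?d * ?e + 2 * ?e * ?p \<le> 2 * (\<bar>?d\<bar> * \<bar>?e\<bar>) + 2 * (\<bar>?e\<bar> * \<bar>?p\<bar>)"
      using abs_ge_self[of "?d * ?e"] abs_ge_self[of "?e * ?p"]
      unfolding abs_mult mult.assoc by linarith
    ultimately have "2 * ?d * ?e + 2 * ?e * ?p \<le> M * (2 * (\<bar>?d\<bar> * \<bar>?e\<bar>))"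
      by (simp add: algebra_simps)
    also have "\<dots> \<le> M * E t"
    proof (rule mult_left_mono)
      show "2 * (\<bar>?d\<bar> * \<bar>?e\<bar>) \<le> E t"
        using zero_le_power2[of "\<bar>?d\<bar> - \<bar>?e\<bar>"] by (simp add: E_def power2_diff)
      have "0 \<le> B\<^sup>2" "0 \<le> B^4" by auto
      then show "0 \<le> M" by (simp add: M)
    qed
    finally show "\<exists>y. ((\<lambda>t. E t * exp (- M * t)) has_real_derivative y) (at t) \<and> y \<le> 0"
      using der by (intro exI[where x = "(2 * ?d * ?e + 2 * ?e * ?p - M * E t) * exp (- M * t)"])
        (simp add: mult_nonpos_nonneg)
  qed
  then have "E x * exp (- M * x) * exp (M * x) \<le> E 0 * exp (M * x)"
    by (simp add: mult_right_mono)
  then show ?thesis by (simp add: E_def mult.assoc exp_add[symmetric])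
qed

section \<open>Higher derivatives as polynomials in a wave and its slope\<close>

lemma real_polynomial_function_along_wave:
  assumes "real_polynomial_function G"
  shows "\<exists>G'. real_polynomial_function G' \<and>
    (\<forall>f v x. wave_solution \<omega> c f v \<longrightarrow>
       ((\<lambda>x. G (f x, v x)) has_real_derivative G' (f x, v x)) (at x))"
  using assms
proof induction
  case (linear h)
  \<comment> \<open>A linear functional on the plane is \<open>a * y + b * z\<close>. Along a wave
    \<open>y\<close> differentiates to the slope and \<open>z\<close> to the force, which is again
    polynomial.\<close>
  define a b where "a = h (1, 0)" and "b = h (0, 1)"
  define G' where "G' = (\<lambda>z::real\<times>real. a * snd z + b * wave_force \<omega> c (fst z))"
  have h: "h (y, z) = a * y + b * z" for y z
  proof -
    interpret bounded_linear h by fact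
    have "h (y, z) = h (y *\<^sub>R (1, 0) + z *\<^sub>R (0, 1))" by simp
    also have "\<dots> = y * h (1, 0) + z * h (0, 1)" by (simp only: add scale real_scaleR_def)
    finally show ?thesis by (simp add: a_def b_def mult.commute)
  qed
  have poly_fst: "real_polynomial_function (fst :: real \<times> real \<Rightarrow> real)"
    and poly_snd: "real_polynomial_function (snd :: real \<times> real \<Rightarrow> real)"
    by (auto intro!: real_polynomial_function.intros(1) bounded_linear_fst bounded_linear_snd)
  have "real_polynomial_function G'"
    unfolding G'_def wave_force_def
    by (intro real_polynomial_function.intros(2-) real_polynomial_function_diff
        real_polynomial_function_power poly_fst poly_snd)
  moreover have "((\<lambda>x. h (f x, v x)) has_real_derivative G' (f x, v x)) (at x)"
    if "wave_solution \<omega> c f v" for f v x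
    unfolding h G'_def
    by (rule derivative_eq_intros wave_solutionD[OF that] refl)+ simp
  ultimately show ?case by blast
next
  case (const a)
  show ?case by (rule exI[of _ "\<lambda>_. 0"]) (auto intro: real_polynomial_function.intros)
next
  case (add G H)
  then obtain G' H' where "real_polynomial_function G'" "real_polynomial_function H'"
    "\<forall>f v x. wave_solution \<omega> c f v \<longrightarrow>
       ((\<lambda>x. G (f x, v x)) has_real_derivative G' (f x, v x)) (at x)"
    "\<forall>f v x. wave_solution \<omega> c f v \<longrightarrow>
       ((\<lambda>x. H (f x, v x)) has_real_derivative H' (f x, v x)) (at x)" by blast
  then show ?case
    by (intro exI[of _ "\<lambda>z. G' z + H' z"] conjI allI impI real_polynomial_function.intros(3) DERIV_add) auto
next
  case (mult G H)
  then obtain G' H' where *: "real_polynomial_function G'" "real_polynomial_function H'"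
    "\<And>f v x. wave_solution \<omega> c f v \<Longrightarrow>
       ((\<lambda>x. G (f x, v x)) has_real_derivative G' (f x, v x)) (at x)"
    "\<And>f v x. wave_solution \<omega> c f v \<Longrightarrow>
       ((\<lambda>x. H (f x, v x)) has_real_derivative H' (f x, v x)) (at x)" by blast
  show ?case
    by (rule exI[of _ "\<lambda>z. G' z * H z + H' z * G z"])
       (intro conjI allI impI real_polynomial_function.intros(3) real_polynomial_function.intros(4)
         DERIV_mult * mult.hyps; assumption)
qed

text \<open>The order of quantifiers matters: \<open>G\<close> is fixed before the two waves, so one
  polynomial serves the whole family in \<open>L\<close> and the limit.\<close>

lemma higher_deriv_wave_diff:
  "\<exists>G. real_polynomial_function G \<and>
    (\<forall>f v h w. wave_solution \<omega> c f v \<longrightarrow> wave_solution \<omega> c h w \<longrightarrow>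
       (deriv ^^ j) (\<lambda>x. f x - h x) = (\<lambda>x. G (f x, v x) - G (h x, w x)))"
proof (induction j)
  case 0
  show ?case
    by (rule exI[of _ fst]) (auto intro!: real_polynomial_function.intros(1) bounded_linear_fst)
next
  case (Suc j)
  then obtain G where G: "real_polynomial_function G"
    "\<And>f v h w. wave_solution \<omega> c f v \<Longrightarrow> wave_solution \<omega> c h w \<Longrightarrow>
       (deriv ^^ j) (\<lambda>x. f x - h x) = (\<lambda>x. G (f x, v x) - G (h x, w x))" by blast
  obtain G' where G': "real_polynomial_function G'"
    "\<And>f v x. wave_solution \<omega> c f v \<Longrightarrow>
       ((\<lambda>x. G (f x, v x)) has_real_derivative G' (f x, v x)) (at x)"
    using real_polynomial_function_along_wave[OF G(1), of \<omega> c] by blast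
  have "(deriv ^^ Suc j) (\<lambda>x. f x - h x) = (\<lambda>x. G' (f x, v x) - G' (h x, w x))"
    if "wave_solution \<omega> c f v" "wave_solution \<omega> c h w" for f v h w
  proof
    fix x
    have "(deriv ^^ Suc j) (\<lambda>x. f x - h x) x = deriv (\<lambda>x. G (f x, v x) - G (h x, w x)) x"
      by (simp add: G(2)[OF that])
    also have "\<dots> = G' (f x, v x) - G' (h x, w x)"
      by (intro DERIV_imp_deriv DERIV_diff G'(2) that)
    finally show "(deriv ^^ Suc j) (\<lambda>x. f x - h x) x = G' (f x, v x) - G' (h x, w x)" .
  qed
  with G'(1) show ?case by blast
qed

text \<open>Each derivative is one fixed polynomial evaluated on trajectories in a common compact
  square, so its uniform continuity turns closeness of the pairs into closeness of the
  derivatives.\<close>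

lemma Cm_norm_wave_diff_tendsto_0:
  assumes sol: "\<forall>\<^sub>F L in at_top. wave_solution \<omega> c (f L) (v L)"
    and lim: "wave_solution \<omega> c h w"
    and bdd: "\<And>x. \<bar>h x\<bar> \<le> B" "\<And>x. \<bar>w x\<bar> \<le> B"
    and conv: "\<And>e. 0 < e \<Longrightarrow>
      \<forall>\<^sub>F L in at_top. \<forall>x\<in>{-L..L}. \<bar>f L x - h x\<bar> < e \<and> \<bar>v L x - w x\<bar> < e"
  shows "((\<lambda>L. Cm_norm m L (\<lambda>x. f L x - h x)) \<longlongrightarrow> 0) at_top"
proof -
  have "((\<lambda>L. Sup ((\<lambda>x. \<bar>(deriv ^^ j) (\<lambda>x. f L x - h x) x\<bar>) ` {-L..L})) \<longlongrightarrow> 0) at_top" for j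
  proof (rule tendstoI)
    fix e :: real assume "0 < e"
    obtain G where G: "real_polynomial_function G"
      "\<And>f v h w. wave_solution \<omega> c f v \<Longrightarrow> wave_solution \<omega> c h w \<Longrightarrow>
        (deriv ^^ j) (\<lambda>x. f x - h x) = (\<lambda>x. G (f x, v x) - G (h x, w x))"
      using higher_deriv_wave_diff[of \<omega> c j] by blast
    \<comment> \<open>The bound \<open>B\<close> for the limit is enlarged by 1 to hold the
      approximating trajectories as well.\<close>
    let ?S = "{-(B+1)..B+1} \<times> {-(B+1)..B+1}"
    have "uniformly_continuous_on ?S G"
      by (intro compact_uniformly_continuous compact_Times compact_Icc)
         (intro continuous_at_imp_continuous_on ballI continuous_real_polymonial_function G(1))
    then obtain d where d: "0 < d"
      "\<And>y z. y \<in> ?S \<Longrightarrow> z \<in> ?S \<Longrightarrow> dist z y < d \<Longrightarrow> dist (G z) (G y) < e/2"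
      using \<open>0 < e\<close> by (elim uniformly_continuous_onE[where \<epsilon> = "e/2"]) auto
    \<comment> \<open>The 1 keeps the trajectory in \<open>?S\<close>; \<open>d/2\<close> in each
      coordinate keeps the distance in the plane below \<open>d\<close>.\<close>
    have "0 < min 1 (d/2)" using d by simp
    from conv[OF this] sol eventually_ge_at_top[of 0]
    show "\<forall>\<^sub>F L in at_top. dist (Sup ((\<lambda>x. \<bar>(deriv ^^ j) (\<lambda>x. f L x - h x) x\<bar>) ` {-L..L})) 0 < e"
    proof eventually_elim
      case (elim L)
      let ?D = "\<lambda>x. \<bar>(deriv ^^ j) (\<lambda>x. f L x - h x) x\<bar>"
      have le: "?D x \<le> e/2" if "x \<in> {-L..L}" for x
      proof -
        have a: "\<bar>f L x - h x\<bar> < min 1 (d/2)" "\<bar>v L x - w x\<bar> < min 1 (d/2)"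
          using elim that by auto
        have "dist (f L x, v L x) (h x, w x) \<le> \<bar>f L x - h x\<bar> + \<bar>v L x - w x\<bar>"
          by (simp add: dist_Pair_Pair dist_real_def sqrt_sum_squares_le_sum_abs[THEN order_trans])
        also have "\<dots> < d" using a by linarith
        finally have "dist (G (f L x, v L x)) (G (h x, w x)) < e/2"
          by (intro d) (use a bdd[of x] in auto)
        then show ?thesis by (simp add: G(2)[OF elim(2) lim] dist_real_def)
      qed
      have "Sup (?D ` {-L..L}) \<le> e/2"
        using elim(3) le by (intro cSUP_least) auto
      \<comment> \<open>Bounding a real \<open>Sup\<close> from below takes boundedness from above,
        so the pointwise estimate enters again; \<open>0 \<le> L\<close> puts 0 in the
        interval.\<close>
      moreover have "0 \<le> Sup (?D ` {-L..L})"
        by (rule cSup_upper2[of "?D 0"]) (use elim(3) le in \<open>auto intro!: bdd_aboveI2[where M = "e/2"]\<close>)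
      ultimately show ?case using \<open>0 < e\<close> by (simp add: dist_real_def)
    qed
  qed
  then have "((\<lambda>L. Cm_norm m L (\<lambda>x. f L x - h x)) \<longlongrightarrow> (\<Sum>j\<le>m. 0)) at_top"
    unfolding Cm_norm_def by (intro tendsto_sum)
  then show ?thesis by simp
qed


section \<open>Convergence of even waves that decrease on [0, L]\<close>

lemma wave_family_Cm_convergence:
  assumes sol: "\<forall>\<^sub>F L in at_top. wave_solution \<omega> c (f L) (v L)"
    and even: "\<forall>\<^sub>F L in at_top. \<forall>x. f L (- x) = f L x"
    and mono: "\<forall>\<^sub>F L in at_top. \<forall>x y. 0 \<le> x \<longrightarrow> x \<le> y \<longrightarrow> y \<le> L \<longrightarrow> 0 \<le> f L y \<and> f L y \<le> f L x"
    and init: "((\<lambda>L. f L 0) \<longlongrightarrow> h 0) at_top"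
    and h: "wave_solution \<omega> c h w" "\<And>x. h (- x) = h x" "\<And>x. 0 \<le> h x" "\<And>x. h x \<le> h 0"
      "(h \<longlongrightarrow> 0) at_top" "wave_potential \<omega> c (h 0) = 0"
  shows "((\<lambda>L. Cm_norm m L (\<lambda>x. f L x - h x)) \<longlongrightarrow> 0) at_top"
proof -
  let ?U = "wave_potential \<omega> c"
  have contU: "continuous_on S ?U" for S
    unfolding wave_potential_def by (intro continuous_intros)
  have odd: "v' (- x) = - v' x" if "wave_solution \<omega> c f' v'" "\<And>x. f' (- x) = f' x" for f' v' x
  proof -
    have "((\<lambda>x. f' (- x)) has_real_derivative v' (- x) * - 1) (at x)"
      by (rule DERIV_chain2[of f']) (auto intro!: wave_solutionD[OF that(1)] derivative_eq_intros)
    then have "(f' has_real_derivative - v' (- x)) (at x)"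
      by (simp add: that(2))
    with wave_solutionD(1)[OF that(1)] show ?thesis
      by (metis DERIV_unique minus_minus)
  qed
  have w0: "w 0 = 0" using odd[OF h(1,2), of 0] by simp
  \<comment> \<open>Evenness makes the slope at 0 vanish and the potential is 0 at
    \<open>h 0\<close>, so the limit wave has energy 0. In particular \<open>w\<close> is bounded by
    the potential on a compact range.\<close>
  have w_sq: "(w x)\<^sup>2 = ?U (h x)" for x
    using wave_solution_energy[OF h(1), of x 0] h(6) w0 by simp
  obtain B where B: "\<And>x. \<bar>h x\<bar> \<le> B" "\<And>x. \<bar>w x\<bar> \<le> B"
  proof -
    have "bounded (?U ` {0..h 0})"
      by (intro compact_imp_bounded compact_continuous_image contU compact_Icc)
    then obtain b where b: "\<And>x. x \<in> {0..h 0} \<Longrightarrow> \<bar>?U x\<bar> \<le> b"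
      unfolding bounded_iff by force
    have "\<bar>w x\<bar> \<le> sqrt b" for x
      using b[of "h x"] h(3,4)[of x] w_sq[of x] by (intro real_le_rsqrt) auto
    moreover have "\<bar>h x\<bar> \<le> h 0" for x using h(3,4)[of x] by simp
    ultimately show ?thesis
      by (intro that[of "max (h 0) (sqrt b)"]) (auto simp: le_max_iff_disj)
  qed
  have conv: "\<forall>\<^sub>F L in at_top. \<forall>x\<in>{-L..L}. \<bar>f L x - h x\<bar> < e \<and> \<bar>v L x - w x\<bar> < e"
    if "0 < e" for e :: real
  proof -
    \<comment> \<open>In the tail, \<open>v\<^sup>2\<close> is a difference of two potentials;
      keeping each below \<open>e\<^sup>2/8\<close> makes it less than
      \<open>(e/2)\<^sup>2\<close>.\<close>
    have e8: "0 < e\<^sup>2/8" using that by simp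
    have U0: "?U 0 = 0" by (simp add: wave_potential_def)
    have "isCont ?U y" for y
      using contU[of UNIV] by (simp add: continuous_on_eq_continuous_at)
    note Ucont = this
    obtain d0 where d0: "0 < d0" "\<And>y. \<bar>y\<bar> < d0 \<Longrightarrow> \<bar>?U y\<bar> < e\<^sup>2/8"
    proof -
      from Ucont[of 0] e8 obtain d0 where "0 < d0" "\<forall>y. dist y 0 < d0 \<longrightarrow> dist (?U y) (?U 0) < e\<^sup>2/8"
        unfolding continuous_at_eps_delta by blast
      then show ?thesis by (intro that[of d0]) (auto simp: U0 dist_real_def)
    qed
    define d where "d = min d0 e"
    have d: "0 < d" "d \<le> e" "\<And>y. \<bar>y\<bar> < d \<Longrightarrow> \<bar>?U y\<bar> < e\<^sup>2/8"
      using d0 that by (auto simp: d_def)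
    have "\<forall>\<^sub>F x in at_top. h x < d/2"
      using h(5) d(1) by (intro order_tendstoD) auto
    then obtain R0 where R0: "\<And>x. R0 \<le> x \<Longrightarrow> h x < d/2"
      by (auto simp: eventually_at_top_linorder)
    \<comment> \<open>\<open>R\<close> separates core and tail: beyond it \<open>h\<close> is below
      \<open>d/2\<close>, and closeness \<open>d/2\<close> at \<open>R\<close> itself will put
      \<open>f L R\<close> below \<open>d\<close>.\<close>
    define R where "R = max R0 0"
    have R: "0 \<le> R" "\<And>x. R \<le> x \<Longrightarrow> h x < d/2" using R0 by (auto simp: R_def)
    \<comment> \<open>The margin 1 over \<open>h 0\<close> absorbs \<open>f L 0\<close> for large
      \<open>L\<close>; by monotonicity it then bounds \<open>f L\<close> on the core.\<close>
    define B' where "B' = h 0 + 1"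
    define M where "M = 1 + (\<bar>\<omega> - c\<^sup>2/4\<bar> + 3 * \<bar>c/2\<bar> * B'\<^sup>2 + 15/16 * B'^4)"
    have M: "0 \<le> M" by (simp add: M_def)
    \<comment> \<open>Both slopes vanish at 0, so only the difference of the initial values is
      amplified, by a factor \<open>exp (M * R)\<close> independent of \<open>L\<close>.\<close>
    have "((\<lambda>L. (f L 0 - h 0)\<^sup>2 * exp (M * R)) \<longlongrightarrow> (h 0 - h 0)\<^sup>2 * exp (M * R)) at_top"
      by (intro tendsto_intros init)
    then have ev1: "\<forall>\<^sub>F L in at_top. (f L 0 - h 0)\<^sup>2 * exp (M * R) < (d/2)\<^sup>2"
      by (rule order_tendstoD) (use d in simp)
    have ev2: "\<forall>\<^sub>F L in at_top. f L 0 < B'"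
      using init by (rule order_tendstoD) (simp add: B'_def)
    have "((\<lambda>L. \<bar>?U (f L 0)\<bar>) \<longlongrightarrow> \<bar>?U (h 0)\<bar>) at_top"
      by (intro tendsto_rabs isCont_tendsto_compose[OF Ucont] init)
    then have ev3: "\<forall>\<^sub>F L in at_top. \<bar>?U (f L 0)\<bar> < e\<^sup>2/8"
      by (rule order_tendstoD) (use e8 h(6) in simp)
    show ?thesis
      using sol even mono ev1 ev2 ev3 eventually_ge_at_top[of R]
    proof eventually_elim
      case (elim L)
      note fsol = elim(1)
      have even: "f L (- x) = f L x" for x using elim(2) by blast
      have dec: "0 \<le> f L y" "f L y \<le> f L x" if "0 \<le> x" "x \<le> y" "y \<le> L" for x y
        using elim(3) that by auto
      have v0: "v L 0 = 0" using odd[OF fsol even, of 0] by simp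
      have near: "\<bar>f L x - h x\<bar> < d/2 \<and> \<bar>v L x - w x\<bar> < d/2" if x: "0 \<le> x" "x \<le> R" for x
      proof -
        have "(f L x - h x)\<^sup>2 + (v L x - w x)\<^sup>2
              \<le> ((f L 0 - h 0)\<^sup>2 + (v L 0 - w 0)\<^sup>2) * exp (M * x)"
        proof (rule wave_solution_continuous_dependence[OF fsol h(1) _ x(1) M_def])
          fix t assume "0 \<le> t" "t \<le> x"
          then have "0 \<le> f L t" "f L t \<le> f L 0" using dec[of 0 t] x elim(7) by auto
          then show "\<bar>f L t\<bar> \<le> B' \<and> \<bar>h t\<bar> \<le> B'"
            using elim(5) h(3,4)[of t] by (auto simp: B'_def)
        qed
        also have "\<dots> \<le> (f L 0 - h 0)\<^sup>2 * exp (M * R)"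
          using x M by (auto simp: v0 w0 intro!: mult_left_mono)
        also have "\<dots> < (d/2)\<^sup>2" by (rule elim(4))
        finally have lt: "(f L x - h x)\<^sup>2 + (v L x - w x)\<^sup>2 < (d/2)\<^sup>2" .
        have "\<bar>f L x - h x\<bar>\<^sup>2 < (d/2)\<^sup>2" "\<bar>v L x - w x\<bar>\<^sup>2 < (d/2)\<^sup>2"
          using lt zero_le_power2[of "f L x - h x"] zero_le_power2[of "v L x - w x"]
          unfolding power2_abs by linarith+
        then have "\<bar>f L x - h x\<bar> < d/2" "\<bar>v L x - w x\<bar> < d/2"
          using d(1) power2_less_imp_less[of "\<bar>f L x - h x\<bar>" "d/2"]
            power2_less_imp_less[of "\<bar>v L x - w x\<bar>" "d/2"] by auto
        then show ?thesis by simp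
      qed
      have half: "\<bar>f L x - h x\<bar> < e \<and> \<bar>v L x - w x\<bar> < e" if x: "0 \<le> x" "x \<le> L" for x
      proof (cases "x \<le> R")
        case True
        with near[of x] x d show ?thesis by auto
      next
        case False
        \<comment> \<open>Monotonicity carries smallness from \<open>R\<close> to the rest of
          \<open>[R, L]\<close>, where continuous dependence would lose uniformity in
          \<open>L\<close>.\<close>
        have "f L x \<le> f L R" "0 \<le> f L x" using dec[of R x] R(1) False x by auto
        moreover have "f L R < d" using near[OF R(1) order_refl] R(2)[OF order_refl] by linarith
        ultimately have fx: "0 \<le> f L x" "f L x < d" by auto
        have hx: "0 \<le> h x" "h x < d" using h(3)[of x] R(2)[of x] False d by auto
        have "(v L x)\<^sup>2 = ?U (f L x) - ?U (f L 0)"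
          using wave_solution_energy[OF fsol, of x 0] v0 by simp
        moreover have "\<bar>?U (f L x)\<bar> < e\<^sup>2/8" "\<bar>?U (h x)\<bar> < e\<^sup>2/8"
          using d(3) fx hx by auto
        ultimately have "(v L x)\<^sup>2 < (e/2)\<^sup>2" "(w x)\<^sup>2 < (e/2)\<^sup>2"
          using elim(6) w_sq[of x] by (auto simp: power_divide)
        then have "\<bar>v L x\<bar> < e/2" "\<bar>w x\<bar> < e/2"
          using \<open>0 < e\<close> power2_less_imp_less[of "\<bar>v L x\<bar>" "e/2"] power2_less_imp_less[of "\<bar>w x\<bar>" "e/2"]
          by auto
        then show ?thesis using fx hx d(2) by auto
      qed
      show ?case
      proof
        fix x assume "x \<in> {-L..L}"
        show "\<bar>f L x - h x\<bar> < e \<and> \<bar>v L x - w x\<bar> < e"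
        proof (cases "0 \<le> x")
          case True
          then show ?thesis using half[of x] \<open>x \<in> {-L..L}\<close> by auto
        next
          case False
          then have "\<bar>f L (-x) - h (-x)\<bar> < e \<and> \<bar>v L (-x) - w (-x)\<bar> < e"
            using half[of "-x"] \<open>x \<in> {-L..L}\<close> by auto
          then show ?thesis
            using odd[OF fsol even, of x] odd[OF h(1,2), of x] even[of x] h(2)[of x]
            by (simp add: abs_minus_commute)
        qed
      qed
    qed
  qed
  show ?thesis by (rule Cm_norm_wave_diff_tendsto_0[OF sol h(1) B conv])
qed

section \<open>The solitary and the periodic wave\<close>

text \<open>Both cases of \<open>Phi\<close> have the form \<open>sqrt (n / q)\<close>. For it the
  equation, divided by the wave and multiplied by \<open>q\<^sup>2\<close>, is the polynomial
  identity assumed here.\<close>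

lemma wave_solution_sqrt_divide:
  assumes q: "\<And>x. 0 < q x" and n: "0 < n"
    and d: "\<And>x. (q has_real_derivative q1 x) (at x)" "\<And>x. (q1 has_real_derivative q2 x) (at x)"
    and id: "\<And>x. 3/4 * (q1 x)\<^sup>2 - 1/2 * q2 x * q x = (\<omega> - c\<^sup>2/4) * (q x)\<^sup>2 + c/2 * n * q x - 3/16 * n\<^sup>2"
  shows "wave_solution \<omega> c (\<lambda>x. sqrt (n / q x)) (\<lambda>x. - sqrt (n / q x) * q1 x / (2 * q x))"
proof -
  let ?f = "\<lambda>x. sqrt (n / q x)" and ?v = "\<lambda>x. - sqrt (n / q x) * q1 x / (2 * q x)"
  have f: "(?f has_real_derivative ?v x) (at x)" for x
  proof -
    have "0 < n / q x" using q n by simp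
    moreover have "inverse (?f x) = ?f x * (q x / n)"
      using q[of x] n by (simp add: real_sqrt_divide field_simps)
    ultimately show ?thesis
      using q[of x] n by (auto intro!: derivative_eq_intros d simp: field_simps power2_eq_square)
  qed
  have v: "(?v has_real_derivative wave_force \<omega> c (?f x)) (at x)" for x
  proof -
    have pos: "0 < q x" by (rule q)
    have "(?v has_real_derivative ?f x * (3/4 * (q1 x)\<^sup>2 - 1/2 * q2 x * q x) / (q x)\<^sup>2) (at x)"
      by (rule derivative_eq_intros f d refl | use pos in force)+
         (use pos in \<open>simp add: field_simps power2_eq_square\<close>)
    also have "?f x * (3/4 * (q1 x)\<^sup>2 - 1/2 * q2 x * q x) / (q x)\<^sup>2
        = ?f x * ((\<omega> - c\<^sup>2/4) + c/2 * (n / q x) - 3/16 * (n / q x)\<^sup>2)"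
      unfolding id using pos by (simp add: field_simps power2_eq_square)
    also have "\<dots> = wave_force \<omega> c (?f x)"
      using pos n by (simp add: wave_force_factor)
    finally show ?thesis .
  qed
  from f v show ?thesis by (simp add: wave_solution_def)
qed

section \<open>The solitary wave\<close>

context wave_parameters
begin

lemma Phi_solution:
  obtains w where "wave_solution \<omega> c (Phi \<omega> c) w"
proof (cases "\<omega> > c\<^sup>2 / 4")
  case True
  define \<kappa> where "\<kappa> = sqrt (4*\<omega> - c\<^sup>2)"
  define q where "q x = sqrt \<omega> * (cosh (\<kappa> * x) - c / (2 * sqrt \<omega>))" for x
  have \<kappa>: "\<kappa>\<^sup>2 = 4*\<omega> - c\<^sup>2" using True by (simp add: \<kappa>_def)
  have r: "0 < sqrt \<omega>" "(sqrt \<omega>)\<^sup>2 = \<omega>" by (rule sqrt_omega)+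
  have q_eq: "q x = sqrt \<omega> * cosh (\<kappa> * x) - c / 2" for x
    using r by (simp add: q_def algebra_simps)
  \<comment> \<open>Equality would force \<open>\<omega> = c\<^sup>2/4\<close>. Strictness keeps
    \<open>q\<close> positive even at \<open>x = 0\<close>, where the hyperbolic cosine is
    1.\<close>
  have "c < 2 * sqrt \<omega>"
    using True r sqrt_omega(3) by (cases "c = 2 * sqrt \<omega>") (auto simp: power_mult_distrib)
  have pos: "0 < q x" for x
  proof -
    have "sqrt \<omega> * 1 \<le> sqrt \<omega> * cosh (\<kappa> * x)"
      using r by (intro mult_left_mono cosh_real_ge_1) auto
    then show ?thesis using \<open>c < 2 * sqrt \<omega>\<close> unfolding q_eq by simp
  qed
  have eq: "Phi \<omega> c = (\<lambda>x. sqrt ((4*\<omega> - c\<^sup>2) / q x))"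
    using True by (auto simp: Phi_def q_def \<kappa>_def)
  have "wave_solution \<omega> c (Phi \<omega> c) (\<lambda>x. - sqrt ((4*\<omega> - c\<^sup>2) / q x) * (sqrt \<omega> * (\<kappa> * sinh (\<kappa> * x))) / (2 * q x))"
    unfolding eq
  proof (rule wave_solution_sqrt_divide[where ?q2.0 = "\<lambda>x. sqrt \<omega> * (\<kappa>\<^sup>2 * cosh (\<kappa> * x))"])
    show "(q has_real_derivative sqrt \<omega> * (\<kappa> * sinh (\<kappa> * x))) (at x)" for x
      unfolding q_def[abs_def] by (auto intro!: derivative_eq_intros)
    show "((\<lambda>x. sqrt \<omega> * (\<kappa> * sinh (\<kappa> * x))) has_real_derivative sqrt \<omega> * (\<kappa>\<^sup>2 * cosh (\<kappa> * x))) (at x)" for x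
      by (auto intro!: derivative_eq_intros simp: power2_eq_square)
    \<comment> \<open>With \<open>R\<close> for \<open>sqrt \<omega>\<close>, \<open>C\<close> for
      the hyperbolic cosine and the squared hyperbolic sine eliminated, the required relation is
      polynomial.\<close>
    have identity: "3/4 * (R\<^sup>2 * (4*R\<^sup>2 - c\<^sup>2) * (C\<^sup>2 - 1)) - 1/2 * (R * ((4*R\<^sup>2 - c\<^sup>2) * C)) * (R * C - c/2)
      = (R\<^sup>2 - c\<^sup>2/4) * (R * C - c/2)\<^sup>2 + c/2 * (4*R\<^sup>2 - c\<^sup>2) * (R * C - c/2) - 3/16 * (4*R\<^sup>2 - c\<^sup>2)\<^sup>2"
      for R C :: real
      by (simp add: power2_eq_square field_simps)
    fix x
    have s: "(sinh (\<kappa> * x))\<^sup>2 = (cosh (\<kappa> * x))\<^sup>2 - 1" by (simp add: sinh_square_eq)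
    have "(sqrt \<omega> * (\<kappa> * sinh (\<kappa> * x)))\<^sup>2 = \<omega> * (4*\<omega> - c\<^sup>2) * ((cosh (\<kappa> * x))\<^sup>2 - 1)"
      by (simp only: power_mult_distrib \<kappa> r(2) s mult.assoc)
    then show "3/4 * (sqrt \<omega> * (\<kappa> * sinh (\<kappa> * x)))\<^sup>2 - 1/2 * (sqrt \<omega> * (\<kappa>\<^sup>2 * cosh (\<kappa> * x))) * q x
      = (\<omega> - c\<^sup>2/4) * (q x)\<^sup>2 + c/2 * (4*\<omega> - c\<^sup>2) * q x - 3/16 * (4*\<omega> - c\<^sup>2)\<^sup>2"
      unfolding q_eq \<kappa> using identity[of "sqrt \<omega>" "cosh (\<kappa> * x)"] unfolding r(2) by simp
  qed (use pos True in auto)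
  then show ?thesis by (rule that)
next
  case False
  then have w: "\<omega> = c\<^sup>2/4" "0 < c" using admissible by auto
  define q where "q x = (c*x)\<^sup>2 + 1" for x
  have eq: "Phi \<omega> c = (\<lambda>x. sqrt (4 * c / q x))"
    using False by (auto simp: Phi_def q_def)
  have "wave_solution \<omega> c (Phi \<omega> c) (\<lambda>x. - sqrt (4 * c / q x) * (2 * c\<^sup>2 * x) / (2 * q x))"
    unfolding eq
  proof (rule wave_solution_sqrt_divide[where ?q2.0 = "\<lambda>x. 2 * c\<^sup>2"])
    show "(q has_real_derivative 2 * c\<^sup>2 * x) (at x)" for x
      unfolding q_def[abs_def] by (auto intro!: derivative_eq_intros simp: power2_eq_square)
    show "((\<lambda>x. 2 * c\<^sup>2 * x) has_real_derivative 2 * c\<^sup>2) (at x)" for x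
      by (auto intro!: derivative_eq_intros)
    show "3/4 * (2 * c\<^sup>2 * x)\<^sup>2 - 1/2 * (2 * c\<^sup>2) * q x
      = (\<omega> - c\<^sup>2/4) * (q x)\<^sup>2 + c/2 * (4*c) * q x - 3/16 * (4*c)\<^sup>2" for x
      by (simp add: w q_def power2_eq_square algebra_simps)
  qed (use w in \<open>auto simp: q_def add_nonneg_pos\<close>)
  then show ?thesis by (rule that)
qed

lemma Phi_even: "Phi \<omega> c (- x) = Phi \<omega> c x"
  by (simp add: Phi_def)

lemma Phi_bounds: "0 \<le> Phi \<omega> c x" "Phi \<omega> c x \<le> Phi \<omega> c 0"
  and Phi_0: "Phi \<omega> c 0 = sqrt (alpha1 \<omega> c)"
  and Phi_tendsto_0: "(Phi \<omega> c \<longlongrightarrow> 0) at_top"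
proof -
  have r: "0 < sqrt \<omega>" "(sqrt \<omega>)\<^sup>2 = \<omega>" by (rule sqrt_omega)+
  have "0 \<le> Phi \<omega> c x \<and> Phi \<omega> c x \<le> Phi \<omega> c 0 \<and> Phi \<omega> c 0 = sqrt (alpha1 \<omega> c) \<and> (Phi \<omega> c \<longlongrightarrow> 0) at_top"
  proof (cases "\<omega> > c\<^sup>2 / 4")
    case True
    define \<kappa> where "\<kappa> = sqrt (4*\<omega> - c\<^sup>2)"
    have \<kappa>: "0 < \<kappa>" using True by (simp add: \<kappa>_def)
    have c2: "c < 2 * sqrt \<omega>"
      using True r sqrt_omega(3) by (cases "c = 2 * sqrt \<omega>") (auto simp: power_mult_distrib)
    then have g: "c / (2 * sqrt \<omega>) < 1" using r by simp
    have eq: "Phi \<omega> c = (\<lambda>x. sqrt ((4*\<omega> - c\<^sup>2) / (sqrt \<omega> * (cosh (\<kappa> * x) - c / (2 * sqrt \<omega>)))))"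
      using True by (auto simp: Phi_def \<kappa>_def)
    have ge: "1 \<le> cosh (\<kappa> * x)" by (rule cosh_real_ge_1)
    have den: "0 < sqrt \<omega> * (cosh (\<kappa> * x) - c / (2 * sqrt \<omega>))" "0 < sqrt \<omega> * (1 - c / (2 * sqrt \<omega>))"
      using r(1) g ge by (auto intro!: mult_pos_pos simp only: diff_gt_0_iff_gt)
    have "0 \<le> Phi \<omega> c x"
      unfolding eq using True den by (intro real_sqrt_ge_zero divide_nonneg_pos) auto
    moreover have "Phi \<omega> c x \<le> Phi \<omega> c 0"
    proof -
      have "(4*\<omega> - c\<^sup>2) / (sqrt \<omega> * (cosh (\<kappa> * x) - c / (2 * sqrt \<omega>)))
            \<le> (4*\<omega> - c\<^sup>2) / (sqrt \<omega> * (1 - c / (2 * sqrt \<omega>)))"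
        using True r(1) ge by (intro divide_left_mono mult_left_mono mult_pos_pos[OF den]) auto
      then show ?thesis unfolding eq by simp
    qed
    moreover have "Phi \<omega> c 0 = sqrt (alpha1 \<omega> c)"
    proof -
      have "sqrt \<omega> * (1 - c / (2 * sqrt \<omega>)) = sqrt \<omega> - c/2" using r by (simp add: algebra_simps)
      \<comment> \<open>A difference of squares whose second factor is the denominator at
        \<open>x = 0\<close>; cancelling it leaves \<open>alpha1\<close>.\<close>
      moreover have "4*\<omega> - c\<^sup>2 = alpha1 \<omega> c * (sqrt \<omega> - c/2)"
        using r(2) by (simp add: alpha1_def power2_eq_square algebra_simps)
      ultimately show ?thesis using c2 by (simp add: eq)
    qed
    moreover have "(Phi \<omega> c \<longlongrightarrow> 0) at_top"
    proof -
      have "filterlim (\<lambda>x. \<kappa> * x) at_top at_top"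
        using \<kappa> by (intro filterlim_tendsto_pos_mult_at_top[OF tendsto_const]) (auto simp: filterlim_ident)
      then have "filterlim (\<lambda>x. cosh (\<kappa> * x)) at_top at_top"
        by (rule filterlim_compose[OF cosh_real_at_top])
      then have "filterlim (\<lambda>x. - (c / (2 * sqrt \<omega>)) + cosh (\<kappa> * x)) at_top at_top"
        by (intro filterlim_tendsto_add_at_top[OF tendsto_const])
      then have "filterlim (\<lambda>x. sqrt \<omega> * (- (c / (2 * sqrt \<omega>)) + cosh (\<kappa> * x))) at_top at_top"
        by (intro filterlim_tendsto_pos_mult_at_top[OF tendsto_const r(1)])
      then have "((\<lambda>x. sqrt ((4*\<omega> - c\<^sup>2) / (sqrt \<omega> * (- (c / (2 * sqrt \<omega>)) + cosh (\<kappa> * x))))) \<longlongrightarrow> sqrt 0) at_top"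
        by (intro tendsto_real_sqrt real_tendsto_divide_at_top[OF tendsto_const])
      then show ?thesis unfolding eq by simp
    qed
    ultimately show ?thesis by simp
  next
    case False
    then have w: "\<omega> = c\<^sup>2/4" "0 < c" using admissible by auto
    have eq: "Phi \<omega> c = (\<lambda>x. sqrt (4 * c / ((c*x)\<^sup>2 + 1)))"
      using False by (auto simp: Phi_def)
    have "0 \<le> Phi \<omega> c x" unfolding eq using w by auto
    moreover have "Phi \<omega> c x \<le> Phi \<omega> c 0"
      unfolding eq using w by (auto simp: divide_le_eq add_nonneg_pos)
    moreover have "sqrt \<omega> = c/2" using w by (intro real_sqrt_unique) (auto simp: power_divide)
    then have "Phi \<omega> c 0 = sqrt (alpha1 \<omega> c)"
      unfolding eq by (simp add: alpha1_def)
    moreover have "(Phi \<omega> c \<longlongrightarrow> 0) at_top"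
    proof -
      have "filterlim (\<lambda>x. c * x) at_top at_top"
        using w by (intro filterlim_tendsto_pos_mult_at_top[OF tendsto_const]) (auto simp: filterlim_ident)
      then have "filterlim (\<lambda>x. (c * x)\<^sup>2) at_top at_top"
        by (intro filterlim_pow_at_top) auto
      then have "filterlim (\<lambda>x. 1 + (c * x)\<^sup>2) at_top at_top"
        by (intro filterlim_tendsto_add_at_top[OF tendsto_const])
      then have "((\<lambda>x. sqrt (4 * c / (1 + (c * x)\<^sup>2))) \<longlongrightarrow> sqrt 0) at_top"
        by (intro tendsto_real_sqrt real_tendsto_divide_at_top[OF tendsto_const])
      then show ?thesis unfolding eq by (simp add: add.commute)
    qed
    ultimately show ?thesis by simp
  qed
  then show "0 \<le> Phi \<omega> c x" "Phi \<omega> c x \<le> Phi \<omega> c 0" "Phi \<omega> c 0 = sqrt (alpha1 \<omega> c)"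
    "(Phi \<omega> c \<longlongrightarrow> 0) at_top" by auto
qed

text \<open>As a function of \<open>y\<^sup>2\<close> the potential has \<open>alpha1\<close> as a
  zero, so the solitary wave lies on the zero energy level, homoclinic to 0.\<close>

lemma wave_potential_Phi_0: "wave_potential \<omega> c (Phi \<omega> c 0) = 0"
proof -
  define y where "y = Phi \<omega> c 0"
  have y: "y\<^sup>2 = alpha1 \<omega> c"
    using alpha0_pos alpha0_less_alpha1 by (simp add: y_def Phi_0)
  have "wave_potential \<omega> c y = y\<^sup>2 / 16 * (16 * \<omega> - (y\<^sup>2 - 2*c)\<^sup>2)"
    by (simp add: wave_potential_def power2_eq_square eval_nat_numeral field_simps)
  also have "\<dots> = 0" using sqrt_omega(2) by (simp add: y alpha1_def power_mult_distrib)
  finally show ?thesis by (simp add: y_def)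
qed

section \<open>The periodic wave, with its maximal square as a free parameter\<close>

definition wave_profile :: "real \<Rightarrow> real \<Rightarrow> real" where
  "wave_profile e x = sqrt (e * (jdn (kmod \<omega> c e) (x / (2 * gpar \<omega> c e)))\<^sup>2 /
     (1 + betasq \<omega> c e * (jsn (kmod \<omega> c e) (x / (2 * gpar \<omega> c e)))\<^sup>2))"

lemma PhiL_eq_wave_profile: "PhiL \<omega> c L = wave_profile (eta3L \<omega> c L)"
  by (rule ext) (simp add: PhiL_def wave_profile_def Let_def)

lemma betasq_eq:
  assumes "alpha0 \<omega> c < e" "e < alpha1 \<omega> c"
  shows "betasq \<omega> c e = (e - eta2 \<omega> c e) / (eta2 \<omega> c e - eta1 \<omega> c e)" "0 < betasq \<omega> c e"
proof -
  note O = eta_order[OF assms] and F = interval_facts[OF assms]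
  show "betasq \<omega> c e = (e - eta2 \<omega> c e) / (eta2 \<omega> c e - eta1 \<omega> c e)"
    using O F by (simp add: betasq_def ksq_def field_simps)
  then show "0 < betasq \<omega> c e" using O by simp
qed

lemma gpar_pos:
  assumes "alpha0 \<omega> c < e" "e < alpha1 \<omega> c"
  shows "0 < gpar \<omega> c e"
  using par_pos[OF assms] by (simp add: gpar_def Ppar_def[symmetric])

text \<open>With amplitude \<open>\<phi>\<close>, the profile is \<open>sqrt e * n / d\<close>,
  where \<open>n\<close> is dn and \<open>d\<^sup>2\<close> is the denominator. Two differentiations
  reduce the equation to an algebraic identity in \<open>s\<close>, the squared sine of the
  amplitude.\<close>

lemma wave_profile_solution:
  assumes e: "alpha0 \<omega> c < e" "e < alpha1 \<omega> c"
  obtains v where "wave_solution \<omega> c (wave_profile e) v"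
proof -
  note O = eta_order[OF e] and F = interval_facts[OF e] and k1 = kmod_sq[OF e]
  define e1 e2 k q b \<kappa> where "e1 = eta1 \<omega> c e" and "e2 = eta2 \<omega> c e" and "k = kmod \<omega> c e"
    and "q = ksq \<omega> c e" and "b = betasq \<omega> c e" and "\<kappa> = 1 / (2 * gpar \<omega> c e)"
  have o: "e1 < 0" "0 < e2" "e2 < e" "0 < e" using O F by (auto simp: e1_def e2_def)
  have q: "q = - e1 * (e - e2) / (e * (e2 - e1))" by (simp add: q_def ksq_def e1_def e2_def)
  have b: "b = (e - e2) / (e2 - e1)" "0 < b"
    using betasq_eq[OF e] by (auto simp: b_def e1_def e2_def)
  have \<kappa>: "\<kappa>\<^sup>2 = e * (e2 - e1) / 16"
    using o by (simp add: \<kappa>_def gpar_def e1_def[symmetric] e2_def[symmetric] power_divide)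
  have c_eq: "c = (e1 + e2 + e) / 4" using eta_sum[of e] by (simp add: e1_def e2_def)
  have a_eq: "\<omega> - c\<^sup>2/4 = - (e1 * e2 + e * (e1 + e2)) / 16"
    using eta_pair_sum[of e] Apol_pos[OF e] by (simp add: e1_def e2_def)
  define \<phi> where "\<phi> x = jam k (\<kappa> * x)" for x
  define n where "n x = sqrt (1 - q * (sin (\<phi> x))\<^sup>2)" for x
  define d where "d x = sqrt (1 + b * (sin (\<phi> x))\<^sup>2)" for x
  have kq: "k\<^sup>2 = q" "k\<^sup>2 < 1" using k1 by (auto simp: k_def q_def)
  have n: "0 < n x" "(n x)\<^sup>2 = 1 - q * (sin (\<phi> x))\<^sup>2" for x
    using elliptic_radicand_pos[OF kq(2), of "\<phi> x"] by (auto simp: n_def kq)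
  have d: "0 < d x" "(d x)\<^sup>2 = 1 + b * (sin (\<phi> x))\<^sup>2" for x
    using b(2) by (auto simp: d_def add_pos_nonneg)
  have \<phi>': "(\<phi> has_real_derivative \<kappa> * n x) (at x)" for x
  proof -
    have "(\<phi> has_real_derivative n x * \<kappa>) (at x)"
      unfolding \<phi>_def[abs_def] n_def kq(1)[symmetric]
      by (rule DERIV_chain2[of "jam k", OF jam_has_real_derivative[OF kq(2)]])
         (auto intro!: derivative_eq_intros)
    then show ?thesis by (simp add: mult.commute)
  qed
  have n': "(n has_real_derivative - q * sin (\<phi> x) * cos (\<phi> x) * \<kappa>) (at x)" for x
  proof -
    have "(n has_real_derivative inverse (n x) / 2 * (- (q * (2 * sin (\<phi> x) * (cos (\<phi> x) * (\<kappa> * n x)))))) (at x)"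
      unfolding n_def[abs_def]
      by (rule derivative_eq_intros \<phi>' refl | use n[of x] in \<open>force simp: n_def\<close>)+
    then show ?thesis using n(1)[of x] by (simp add: field_simps)
  qed
  have d': "(d has_real_derivative b * sin (\<phi> x) * cos (\<phi> x) * \<kappa> * n x / d x) (at x)" for x
  proof -
    have "(d has_real_derivative inverse (d x) / 2 * (b * (2 * sin (\<phi> x) * (cos (\<phi> x) * (\<kappa> * n x))))) (at x)"
      unfolding d_def[abs_def]
      by (rule derivative_eq_intros \<phi>' refl | use d[of x] in \<open>force simp: d_def\<close>)+
    then show ?thesis using d(1)[of x] by (simp add: field_simps)
  qed
  have f_eq: "wave_profile e = (\<lambda>x. sqrt e * n x / d x)"
  proof
    fix x
    have "wave_profile e x = sqrt (e * (n x)\<^sup>2 / (d x)\<^sup>2)"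
      unfolding d(2) by (simp add: wave_profile_def jdn_def jsn_def k_def[symmetric] b_def[symmetric]
          \<phi>_def n_def kq(1) \<kappa>_def)
    then show "wave_profile e x = sqrt e * n x / d x"
      using n(1)[of x] d(1)[of x] by (simp add: real_sqrt_divide real_sqrt_mult)
  qed
  \<comment> \<open>The quotient rule produces \<open>q * d\<^sup>2 + b * n\<^sup>2\<close>, in
    which the sine terms cancel; hence the constant \<open>q + b\<close>.\<close>
  define v where "v x = - sqrt e * \<kappa> * (q + b) * (sin (\<phi> x) * cos (\<phi> x)) / (d x)^3" for x
  have "(wave_profile e has_real_derivative v x) (at x)" for x
  proof -
    have "(wave_profile e has_real_derivative
       sqrt e * (- q * sin (\<phi> x) * cos (\<phi> x) * \<kappa> * d x - n x * (b * sin (\<phi> x) * cos (\<phi> x) * \<kappa> * n x / d x)) / (d x)\<^sup>2) (at x)"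
      unfolding f_eq
      by (rule derivative_eq_intros n' d' refl | use d(1)[of x] in force)+
         (simp add: power2_eq_square algebra_simps)
    also have "sqrt e * (- q * sin (\<phi> x) * cos (\<phi> x) * \<kappa> * d x - n x * (b * sin (\<phi> x) * cos (\<phi> x) * \<kappa> * n x / d x)) / (d x)\<^sup>2
      = - sqrt e * \<kappa> * (sin (\<phi> x) * cos (\<phi> x)) * (q * (d x)\<^sup>2 + b * (n x)\<^sup>2) / (d x)^3"
      using d(1)[of x] by (simp add: field_simps power2_eq_square power3_eq_cube)
    also have "q * (d x)\<^sup>2 + b * (n x)\<^sup>2 = q + b" by (simp add: n(2) d(2) algebra_simps)
    finally show ?thesis by (simp add: v_def mult_ac)
  qed
  moreover have "(v has_real_derivative wave_force \<omega> c (wave_profile e x)) (at x)" for x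
  proof -
    define s where "s = (sin (\<phi> x))\<^sup>2"
    have cs: "(cos (\<phi> x))\<^sup>2 = 1 - s" by (simp add: s_def cos_squared_eq)
    have "(v has_real_derivative - sqrt e * \<kappa> * (q + b) *
       (((cos (\<phi> x))\<^sup>2 - (sin (\<phi> x))\<^sup>2) * (\<kappa> * n x) * (d x)^3 -
        (sin (\<phi> x) * cos (\<phi> x)) * (3 * (d x)\<^sup>2 * (b * sin (\<phi> x) * cos (\<phi> x) * \<kappa> * n x / d x)))
        / ((d x)^3)\<^sup>2) (at x)"
      unfolding v_def[abs_def]
      by (rule derivative_eq_intros \<phi>' d' refl | use d(1)[of x] in force)+
         (simp add: power2_eq_square algebra_simps)
    also have "- sqrt e * \<kappa> * (q + b) *
       (((cos (\<phi> x))\<^sup>2 - (sin (\<phi> x))\<^sup>2) * (\<kappa> * n x) * (d x)^3 -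
        (sin (\<phi> x) * cos (\<phi> x)) * (3 * (d x)\<^sup>2 * (b * sin (\<phi> x) * cos (\<phi> x) * \<kappa> * n x / d x)))
        / ((d x)^3)\<^sup>2
      = sqrt e * n x / (d x)^5 * (- \<kappa>\<^sup>2 * (q + b) *
         (((cos (\<phi> x))\<^sup>2 - (sin (\<phi> x))\<^sup>2) * (d x)\<^sup>2 - 3 * b * (sin (\<phi> x))\<^sup>2 * (cos (\<phi> x))\<^sup>2))"
      using d(1)[of x] by (simp add: field_simps eval_nat_numeral)
    also have "- \<kappa>\<^sup>2 * (q + b) *
         (((cos (\<phi> x))\<^sup>2 - (sin (\<phi> x))\<^sup>2) * (d x)\<^sup>2 - 3 * b * (sin (\<phi> x))\<^sup>2 * (cos (\<phi> x))\<^sup>2)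
      = - \<kappa>\<^sup>2 * (q + b) * ((1 - 2 * s) * (1 + b * s) - 3 * b * s * (1 - s))"
      unfolding cs d(2) s_def[symmetric] by simp
    \<comment> \<open>The squared profile is \<open>e * (1 - q * s) / (1 + b * s)\<close>; the right
      side is force over profile, multiplied by \<open>(1 + b * s)\<^sup>2\<close>.\<close>
    also have "\<dots> = (\<omega> - c\<^sup>2/4) * (1 + b * s)\<^sup>2 + c/2 * e * (1 - q * s) * (1 + b * s) - 3/16 * e\<^sup>2 * (1 - q * s)\<^sup>2"
    proof -
      \<comment> \<open>Multiplication by \<open>w\<close> turns \<open>b\<close> and
        \<open>e * q\<close> into polynomials in the roots, so \<open>16 * w\<^sup>2\<close> clears
        every denominator in the identity.\<close>
      define w Y Z where "w = e2 - e1" and "Y = 1 + b * s" and "Z = e * (1 - q * s)"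
      have w: "w \<noteq> 0" "e \<noteq> 0" using o by (auto simp: w_def)
      have bw: "w * b = e - e2" using w by (simp add: b(1) w_def)
      have qw: "w * (e * q) = - e1 * (e - e2)" using w by (simp add: q w_def)
      have kw: "16 * (\<kappa>\<^sup>2 * (q + b)) = (e - e2) * (e - e1)"
      proof -
        have "16 * (\<kappa>\<^sup>2 * (q + b)) = w * (e * q) + e * (w * b)"
          by (simp add: \<kappa> w_def field_simps)
        then show ?thesis unfolding bw qw by (simp add: algebra_simps)
      qed
      have Y: "w * Y = w + (e - e2) * s"
        using bw by (simp add: Y_def distrib_left mult.assoc[symmetric])
      have Z: "w * Z = e * w + e1 * (e - e2) * s"
      proof -
        have "w * Z = e * w - w * (e * q) * s" by (simp add: Z_def algebra_simps)
        then show ?thesis unfolding qw by simp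
      qed
      \<comment> \<open>The whole verification condensed into one polynomial identity in
        \<open>e\<close>, \<open>e1\<close>, \<open>e2\<close> and \<open>s\<close>.\<close>
      have poly: "- ((e - e2) * (e - e1)) * ((1 - 2 * s) * (w * (w + (e - e2) * s)) - 3 * (w * (e - e2)) * s * (1 - s))
          = - (e1 * e2 + e * (e1 + e2)) * (w + (e - e2) * s)\<^sup>2
            + 2 * (e1 + e2 + e) * (e * w + e1 * (e - e2) * s) * (w + (e - e2) * s)
            - 3 * (e * w + e1 * (e - e2) * s)\<^sup>2"
        unfolding w_def by algebra
      have "16 * w\<^sup>2 * (- \<kappa>\<^sup>2 * (q + b) * ((1 - 2 * s) * Y - 3 * b * s * (1 - s)))
          = - (16 * (\<kappa>\<^sup>2 * (q + b))) * ((1 - 2 * s) * (w * (w * Y)) - 3 * (w * (w * b)) * s * (1 - s))"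
        by (simp add: power2_eq_square algebra_simps)
      also have "\<dots> = - (e1 * e2 + e * (e1 + e2)) * (w * Y)\<^sup>2
            + 2 * (e1 + e2 + e) * (w * Z) * (w * Y) - 3 * (w * Z)\<^sup>2"
        unfolding kw bw Y Z by (rule poly)
      also have "\<dots> = 16 * w\<^sup>2 * (- (e1 * e2 + e * (e1 + e2)) / 16 * Y\<^sup>2
            + (e1 + e2 + e) / 4 / 2 * Z * Y - 3/16 * Z\<^sup>2)"
        by (simp add: power2_eq_square field_simps)
      also have "\<dots> = 16 * w\<^sup>2 * ((\<omega> - c\<^sup>2/4) * Y\<^sup>2 + c/2 * Z * Y - 3/16 * Z\<^sup>2)"
        by (simp only: a_eq c_eq[symmetric])
      finally have "- \<kappa>\<^sup>2 * (q + b) * ((1 - 2 * s) * Y - 3 * b * s * (1 - s))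
          = (\<omega> - c\<^sup>2/4) * Y\<^sup>2 + c/2 * Z * Y - 3/16 * Z\<^sup>2"
        by (rule mult_left_cancel[THEN iffD1, rotated]) (use w in simp)
      then show ?thesis unfolding Y_def Z_def power_mult_distrib mult.assoc .
    qed
    also have "sqrt e * n x / (d x)^5 * \<dots> = wave_force \<omega> c (sqrt e * n x / d x)"
    proof -
      have "a * (d x)^4 + c/2 * e * N * (d x)\<^sup>2 - 3/16 * e\<^sup>2 * N\<^sup>2
          = (d x)^4 * (a + c/2 * (e * N / (d x)\<^sup>2) - 3/16 * (e * N / (d x)\<^sup>2)\<^sup>2)" for a N
        using d(1)[of x] by (simp add: field_simps eval_nat_numeral)
      note factor = this[of "\<omega> - c\<^sup>2/4" "(n x)\<^sup>2"]
      have "(sqrt e * n x / d x)\<^sup>2 = e * (n x)\<^sup>2 / (d x)\<^sup>2"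
        using o by (simp add: power_mult_distrib power_divide)
      moreover have "((d x)\<^sup>2)\<^sup>2 = (d x)^4" by simp
      moreover have "sqrt e * n x / (d x)^5 * ((d x)^4 * r) = sqrt e * n x / d x * r" for r
        using d(1)[of x] by (simp add: eval_nat_numeral)
      ultimately show ?thesis
        unfolding s_def n(2)[symmetric] d(2)[symmetric] wave_force_factor
        by (simp only: factor)
    qed
    finally show ?thesis by (simp add: f_eq)
  qed
  ultimately have "wave_solution \<omega> c (wave_profile e) v" by (simp add: wave_solution_def)
  then show ?thesis by (rule that)
qed

lemma wave_profile_even:
  assumes "alpha0 \<omega> c < e" "e < alpha1 \<omega> c"
  shows "wave_profile e (- x) = wave_profile e x"
  using jam_minus[OF kmod_sq(2)[OF assms], of "x / (2 * gpar \<omega> c e)"]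
  by (simp add: wave_profile_def jdn_def jsn_def)

lemma wave_profile_0:
  assumes "alpha0 \<omega> c < e" "e < alpha1 \<omega> c"
  shows "wave_profile e 0 = sqrt e"
  by (simp add: wave_profile_def jdn_def jsn_def jam_0[OF kmod_sq(2)[OF assms]])

text \<open>The period condition says \<open>L / (2 * g) = K\<close>, so on \<open>[0, L]\<close>
  the amplitude runs from 0 to pi/2. There the sine increases, and the profile decreases in its
  square.\<close>

lemma wave_profile_decreasing:
  assumes e: "alpha0 \<omega> c < e" "e < alpha1 \<omega> c" and T: "Tper \<omega> c e = 2 * L"
    and xy: "0 \<le> x" "x \<le> y" "y \<le> L"
  shows "0 \<le> wave_profile e y" "wave_profile e y \<le> wave_profile e x"
proof -
  let ?k = "kmod \<omega> c e" and ?g = "gpar \<omega> c e" and ?b = "betasq \<omega> c e"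
  note k = kmod_sq(2)[OF e] and g = gpar_pos[OF e] and b = betasq_eq(2)[OF e]
  have epos: "0 < e" by (rule interval_facts[OF e])
  have rad: "0 < 1 - ?k\<^sup>2 * (sin t)\<^sup>2" for t by (rule elliptic_radicand_pos[OF k])
  have den: "0 < 1 + ?b * (sin t)\<^sup>2" for t using b by (simp add: add_pos_nonneg)
  let ?u = "jam ?k (x / (2 * ?g))" and ?w = "jam ?k (y / (2 * ?g))"
  show "0 \<le> wave_profile e y"
    unfolding wave_profile_def jsn_def using epos den[of ?w] by simp
  have "y / (2 * ?g) \<le> ellK ?k" using xy T g by (simp add: Tper_def field_simps)
  then have "?w \<le> pi/2" using jam_mono[OF k] jam_ellK[OF k] by metis
  moreover have "0 \<le> ?u" using jam_mono[OF k, of 0 "x / (2 * ?g)"] k xy g by simp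
  moreover have "?u \<le> ?w" using xy g by (intro jam_mono k) (simp add: divide_right_mono)
  ultimately have "sin ?u \<le> sin ?w" "0 \<le> sin ?u"
    by (auto intro!: sin_monotone_2pi_le sin_ge_zero)
  then have s: "(sin ?u)\<^sup>2 \<le> (sin ?w)\<^sup>2" by (intro power_mono)
  have "e * (1 - ?k\<^sup>2 * (sin ?w)\<^sup>2) / (1 + ?b * (sin ?w)\<^sup>2)
         \<le> e * (1 - ?k\<^sup>2 * (sin ?u)\<^sup>2) / (1 + ?b * (sin ?u)\<^sup>2)"
    using s b epos rad[of ?u] rad[of ?w] den[of ?u] den[of ?w]
    by (intro frac_le) (auto intro!: mult_left_mono)
  then show "wave_profile e y \<le> wave_profile e x"
    using rad[of ?u] rad[of ?w] by (simp add: wave_profile_def jdn_def jsn_def)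
qed

lemma Cm_norm_PhiL_diff_Phi_tendsto_0:
  "((\<lambda>L. Cm_norm m L (\<lambda>x. PhiL \<omega> c L x - Phi \<omega> c x)) \<longlongrightarrow> 0) at_top"
proof -
  obtain w where w: "wave_solution \<omega> c (Phi \<omega> c) w" by (rule Phi_solution)
  \<comment> \<open>Slopes are known to exist separately for each large \<open>L\<close>; the choice
    operator assembles them into a family.\<close>
  define v where "v L = (SOME v. wave_solution \<omega> c (PhiL \<omega> c L) v)" for L
  show ?thesis
  proof (rule wave_family_Cm_convergence[of \<omega> c _ v])
    show "\<forall>\<^sub>F L in at_top. wave_solution \<omega> c (PhiL \<omega> c L) (v L)"
      using eventually_eta3L
    proof eventually_elim
      case (elim L)
      then have "\<exists>v. wave_solution \<omega> c (PhiL \<omega> c L) v"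
        using wave_profile_solution[of "eta3L \<omega> c L"] by (auto simp: PhiL_eq_wave_profile)
      then show ?case unfolding v_def by (rule someI_ex)
    qed
    show "\<forall>\<^sub>F L in at_top. \<forall>x. PhiL \<omega> c L (- x) = PhiL \<omega> c L x"
      using eventually_eta3L
      by eventually_elim (simp add: PhiL_eq_wave_profile wave_profile_even)
    show "\<forall>\<^sub>F L in at_top. \<forall>x y. 0 \<le> x \<longrightarrow> x \<le> y \<longrightarrow> y \<le> L \<longrightarrow>
        0 \<le> PhiL \<omega> c L y \<and> PhiL \<omega> c L y \<le> PhiL \<omega> c L x"
      using eventually_eta3L
      by eventually_elim (auto simp: PhiL_eq_wave_profile intro!: wave_profile_decreasing)
    have "\<forall>\<^sub>F L in at_top. PhiL \<omega> c L 0 = sqrt (eta3L \<omega> c L)"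
      using eventually_eta3L
      by eventually_elim (simp add: PhiL_eq_wave_profile wave_profile_0)
    moreover have "((\<lambda>L. sqrt (eta3L \<omega> c L)) \<longlongrightarrow> Phi \<omega> c 0) at_top"
      unfolding Phi_0 by (intro tendsto_real_sqrt eta3L_tendsto)
    ultimately show "((\<lambda>L. PhiL \<omega> c L 0) \<longlongrightarrow> Phi \<omega> c 0) at_top"
      by (simp cong: tendsto_cong)
  qed (use w Phi_even Phi_bounds Phi_tendsto_0 wave_potential_Phi_0 in auto)
qed

end

theorem theorem1p3:
  fixes \<omega> c :: real and m :: nat
  assumes "\<omega> > c\<^sup>2 / 4 \<or> (\<omega> = c\<^sup>2 / 4 \<and> c > 0)"
  shows "((\<lambda>L. Cm_norm m L (\<lambda>x. PhiL \<omega> c L x - Phi \<omega> c x)) \<longlongrightarrow> 0) at_top"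
proof -
  interpret wave_parameters \<omega> c by unfold_locales (fact assms)
  show ?thesis by (rule Cm_norm_PhiL_diff_Phi_tendsto_0)
qed

end
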